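(* Let $(\mathfrak g,J_M)$ be a $6$-dimensional real nilpotent Lie algebra with a 1-abelian complex structure. Then $(\mathfrak g,J_M)$ is isomorphic to: (1) Singular of maximal type case: $(\mathfrak h_5,J^3_{s1})$; (2) Regular Hermitian case: $(\mathfrak h_3,J_{3,2,0})$; $(\mathfrak h_3,J_{3,1,0})$; (3) Regular and non-Hermitian case: $(\mathfrak h_4,J^3_{r1})$; $(\mathfrak h_5,J^3_{r2})$; $(\mathfrak h_2,J^3_{r3})$. Here the cases refer to the matrix $M\in M_2(\mathbb C)$ defining $J_M$.
   Context: For a complex structure $J$ on a real Lie algebra $\mathfrak g$, $\mathfrak g^{1,0}\subset\mathfrak g^*_{\mathbb C}$ is the space of $(1,0)$-forms and $d$ is the Chevalley–Eilenberg differential. We write $\sigma^{j\bar k}=\sigma^j\wedge\overline{\sigma^k}$. $J$ is abelian if $[Jx,Jy]=[x,y]$ for all $x,y$. An abelian complex structure on a $2n$-dimensional nilpotent Lie algebra is 1-abelian if $h^{1,0}=\dim H^{1,0}_{\bar\partial}(\mathfrak g)=\dim\ker(\bar\partial:\mathfrak g^{1,0}\to\bigwedge^{1,1}\mathfrak g^* )$ equals $n-1$. For every 1-abelian complex structure there are a basis $\{\omega^i\}_{i=1}^n$ of $\mathfrak g^{1,0}$ and a nonzero $M\in M_{n-1}(\mathbb C)$ with $d\omega^1=\dots=d\omega^{n-1}=0$ and $d\omega^n=\sum_{j,k=1}^{n-1}M_{jk}\,\omega^{j\bar k}$; the structure is then denoted $J_M$. Regular means invertible; $M$ is Hermitian if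 $M=M^*$, where $M^*=\bar M^T$. Maximal type. Let $M$ be a singular $k\times k$ complex matrix and $m_1=k-\mathrm{rank}(M)$. Choose an invertible $S$ such that the last $m_1$ rows of $SM$ vanish, and write $SMS^*=\begin{pmatrix}M'&N\\0&0_{m_1}\end{pmatrix}$ with $M'$ square of size $k-m_1$; put $m_2=\mathrm{rank}(N)$ (independent of $S$). $J_M$ is of maximal type if $m_1=m_2$. Complex structures: in all cases $d\sigma^1=d\sigma^2=0$ for a basis $\{\sigma^i\}_{i=1}^3$ of $\mathfrak g^{1,0}$, and $J^3_{s1}$: $d\sigma^3=\sigma^{1\bar2}$; $J_{3,2,0}$: $d\sigma^3=\sigma^{1\bar1}+\sigma^{2\bar2}$; $J_{3,1,0}$: $d\sigma^3=\sigma^{1\bar1}-\sigma^{2\bar2}$; $J^3_{r1}$: $d\sigma^3=\sigma^{1\bar2}+\sigma^{2\bar1}+i\sigma^{2\bar2}$; $J^3_{r2}$: $d\sigma^3=\sigma^{1\bar2}+\mu\,\sigma^{2\bar1}$, $\mu\in\mathbb R$, $1<\mu<+\infty$; $J^3_{r3}$: $d\sigma^3=\sigma^{1\bar1}+\lambda\,\sigma^{2\bar2}$, $\lambda=e^{i\theta}$, $\theta\in(0,\pi)$. Lie algebras (Salamon's notation): $(de^1,\dots,de^6)$ in a basis of real $1$-forms, with $jk$ for $e^j\wedge e^k$: $\mathfrak h_2=(0,0,0,0,12,34)$, $\mathfrak h_3=(0,0,0,0,0,12+34)$, $\mathfrak h_4=(0,0,0,0,12,14+23)$, $\mathfrak 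h_5=(0,0,0,0,13+42,14+23)$.
   Formalization: "Hermitian" means that some matrix defining the structure is Hermitian, "non-Hermitian" that none is; for a single M item (3) is false: M = iI is regular and non-Hermitian but defines J_{3,2,0} on h_3. Items (1)-(3) are implications by case. *)

theory Defs
  imports
    "HOL-Analysis.Analysis"
    "HOL-Library.Function_Algebras"
    "Jordan_Normal_Form.Schur_Decomposition"
    "Jordan_Normal_Form.DL_Rank"
begin

no_notation Matrix.vec_index (infixl "$" 100)

section \<open>Real Lie algebras\<close>

text \<open>A Lie algebra is a real vector space, given by a type, together with a bracket on it.\<close>

definition lie_algebra :: "('g::real_vector \<Rightarrow> 'g \<Rightarrow> 'g) \<Rightarrow> bool" where
  "lie_algebra br \<longleftrightarrow> bilinear br \<and> (\<forall>x. br x x = 0) \<and>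
     (\<forall>x y z. br x (br y z) + br y (br z x) + br z (br x y) = 0)"

primrec lower_central :: "('g::real_vector \<Rightarrow> 'g \<Rightarrow> 'g) \<Rightarrow> nat \<Rightarrow> 'g set" where
  "lower_central br 0 = UNIV"
| "lower_central br (Suc k) = span {br x y | x y. y \<in> lower_central br k}"

definition nilpotent_lie :: "('g::real_vector \<Rightarrow> 'g \<Rightarrow> 'g) \<Rightarrow> bool" where
  "nilpotent_lie br \<longleftrightarrow> (\<exists>k. lower_central br k = {0})"


section \<open>Complex-valued forms\<close>

text \<open>Elements of the complexified dual are the real-linear functions \<open>'g \<Rightarrow> complex\<close>, and complex
  2-forms are alternating real-bilinear functions \<open>'g \<Rightarrow> 'g \<Rightarrow> complex\<close>. Spans, independence and
  dimension of spaces of 1-forms are taken over the complex numbers.\<close>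

definition cscale :: "complex \<Rightarrow> ('a \<Rightarrow> complex) \<Rightarrow> 'a \<Rightarrow> complex" where
  "cscale c f = (\<lambda>x. c * f x)"

global_interpretation cform: vector_space cscale
  by unfold_locales (auto simp: cscale_def fun_eq_iff algebra_simps)

definition cnj_form :: "('g \<Rightarrow> complex) \<Rightarrow> 'g \<Rightarrow> complex" where
  "cnj_form \<alpha> x = cnj (\<alpha> x)"

definition wedge :: "('g \<Rightarrow> 'a::comm_ring) \<Rightarrow> ('g \<Rightarrow> 'a) \<Rightarrow> 'g \<Rightarrow> 'g \<Rightarrow> 'a" where
  "wedge \<alpha> \<beta> x y = \<alpha> x * \<beta> y - \<alpha> y * \<beta> x"

definition wedge_bar :: "(nat \<Rightarrow> 'g \<Rightarrow> complex) \<Rightarrow> nat \<Rightarrow> nat \<Rightarrow> 'g \<Rightarrow> 'g \<Rightarrow> complex" where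
  "wedge_bar \<sigma> j k = wedge (\<sigma> j) (cnj_form (\<sigma> k))"

definition ce_d :: "('g \<Rightarrow> 'g \<Rightarrow> 'g) \<Rightarrow> ('g \<Rightarrow> complex) \<Rightarrow> 'g \<Rightarrow> 'g \<Rightarrow> complex" where
  "ce_d br \<alpha> x y = - \<alpha> (br x y)"


section \<open>Complex structures\<close>

text \<open>The last condition is the vanishing of the Nijenhuis tensor (integrability).\<close>

definition complex_structure :: "('g::real_vector \<Rightarrow> 'g \<Rightarrow> 'g) \<Rightarrow> ('g \<Rightarrow> 'g) \<Rightarrow> bool" where
  "complex_structure br J \<longleftrightarrow> linear J \<and> (\<forall>x. J (J x) = - x) \<and>
     (\<forall>x y. br (J x) (J y) - br x y - J (br (J x) y + br x (J y)) = 0)"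

definition abelian_complex_structure :: "('g::real_vector \<Rightarrow> 'g \<Rightarrow> 'g) \<Rightarrow> ('g \<Rightarrow> 'g) \<Rightarrow> bool" where
  "abelian_complex_structure br J \<longleftrightarrow>
     complex_structure br J \<and> (\<forall>x y. br (J x) (J y) = br x y)"

definition forms10 :: "('g::real_vector \<Rightarrow> 'g) \<Rightarrow> ('g \<Rightarrow> complex) set" where
  "forms10 J = {\<alpha>. linear \<alpha> \<and> (\<forall>x. \<alpha> (J x) = \<i> * \<alpha> x)}"

text \<open>The pullback by \<open>J\<close> acts on forms of type (1,1) as \<open>1\<close> and on forms of type (2,0) and (0,2)
  as \<open>-1\<close>; hence the (1,1) component of a 2-form is its \<open>J\<close>-invariant part.\<close>

definition part11 :: "('g \<Rightarrow> 'g) \<Rightarrow> ('g \<Rightarrow> 'g \<Rightarrow> complex) \<Rightarrow> 'g \<Rightarrow> 'g \<Rightarrow> complex" where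
  "part11 J \<Omega> x y = (\<Omega> x y + \<Omega> (J x) (J y)) / 2"

definition dbar :: "('g \<Rightarrow> 'g \<Rightarrow> 'g) \<Rightarrow> ('g \<Rightarrow> 'g) \<Rightarrow> ('g \<Rightarrow> complex) \<Rightarrow> 'g \<Rightarrow> 'g \<Rightarrow> complex" where
  "dbar br J \<alpha> = part11 J (ce_d br \<alpha>)"

definition h10 :: "('g::real_vector \<Rightarrow> 'g \<Rightarrow> 'g) \<Rightarrow> ('g \<Rightarrow> 'g) \<Rightarrow> nat" where
  "h10 br J = cform.dim {\<alpha> \<in> forms10 J. dbar br J \<alpha> = 0}"

text \<open>A 1-abelian complex structure on a nilpotent Lie algebra of real dimension \<open>2n\<close>.\<close>

definition one_abelian :: "nat \<Rightarrow> ('g::real_vector \<Rightarrow> 'g \<Rightarrow> 'g) \<Rightarrow> ('g \<Rightarrow> 'g) \<Rightarrow> bool" where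
  "one_abelian n br J \<longleftrightarrow>
     n \<ge> 1 \<and> lie_algebra br \<and> dim (UNIV :: 'g set) = 2 * n \<and> nilpotent_lie br \<and>
     abelian_complex_structure br J \<and> h10 br J = n - 1"

definition basis10 :: "nat \<Rightarrow> ('g::real_vector \<Rightarrow> 'g) \<Rightarrow> (nat \<Rightarrow> 'g \<Rightarrow> complex) \<Rightarrow> bool" where
  "basis10 n J \<sigma> \<longleftrightarrow> inj_on \<sigma> {1..n} \<and> cform.independent (\<sigma> ` {1..n}) \<and>
     cform.span (\<sigma> ` {1..n}) = forms10 J"

text \<open>\<open>defining_matrix n br J \<omega> M\<close>: the structure \<open>J\<close> is \<open>J\<^sub>M\<close> with respect to the basis \<open>\<omega>\<close>.
  Forms are indexed from \<open>1\<close>, matrix entries from \<open>0\<close>.\<close>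

definition defining_matrix ::
  "nat \<Rightarrow> ('g::real_vector \<Rightarrow> 'g \<Rightarrow> 'g) \<Rightarrow> ('g \<Rightarrow> 'g) \<Rightarrow> (nat \<Rightarrow> 'g \<Rightarrow> complex) \<Rightarrow> complex mat \<Rightarrow> bool"
  where
  "defining_matrix n br J \<omega> M \<longleftrightarrow>
     basis10 n J \<omega> \<and> M \<in> carrier_mat (n - 1) (n - 1) \<and> M \<noteq> 0\<^sub>m (n - 1) (n - 1) \<and>
     (\<forall>i \<in> {1..n - 1}. ce_d br (\<omega> i) = 0) \<and>
     ce_d br (\<omega> n) =
       (\<lambda>x y. \<Sum>j = 1..n - 1. \<Sum>k = 1..n - 1. M $$ (j - 1, k - 1) * wedge_bar \<omega> j k x y)"


section \<open>Types of matrices\<close>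

definition hermitian_mat :: "complex mat \<Rightarrow> bool" where
  "hermitian_mat M \<longleftrightarrow> M = mat_adjoint M"

text \<open>Rescaling \<open>\<omega>\<^sup>n\<close> multiplies the matrix defining \<open>J\<close> by an arbitrary nonzero complex number, so being
  Hermitian is not a property of one particular defining matrix: \<open>\<i>\<close> times a Hermitian matrix \<open>H\<close>
  defines the same structure as \<open>H\<close>. The structure is Hermitian if some matrix defining it is.
  In contrast, regularity and maximal type do not depend on the defining matrix.\<close>

definition hermitian_case :: "nat \<Rightarrow> ('g::real_vector \<Rightarrow> 'g \<Rightarrow> 'g) \<Rightarrow> ('g \<Rightarrow> 'g) \<Rightarrow> bool" where
  "hermitian_case n br J \<longleftrightarrow> (\<exists>\<omega> M. defining_matrix n br J \<omega> M \<and> hermitian_mat M)"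

definition corank :: "complex mat \<Rightarrow> nat" where
  "corank M = dim_row M - vec_space.rank (dim_row M) M"

text \<open>\<open>off_diagonal_rank M m\<^sub>2\<close>: for some admissible \<open>S\<close> the block \<open>N\<close> of \<open>S M S\<^sup>*\<close> has rank \<open>m\<^sub>2\<close>
  (the rank does not depend on the choice of \<open>S\<close>).\<close>

definition off_diagonal_rank :: "complex mat \<Rightarrow> nat \<Rightarrow> bool" where
  "off_diagonal_rank M m2 \<longleftrightarrow>
     (let k = dim_row M; m1 = corank M in
      \<exists>S M' N. S \<in> carrier_mat k k \<and> invertible_mat S \<and>
        (\<forall>i \<in> {k - m1..<k}. row (S * M) i = 0\<^sub>v k) \<and>
        M' \<in> carrier_mat (k - m1) (k - m1) \<and> N \<in> carrier_mat (k - m1) m1 \<and>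
        S * M * mat_adjoint S = four_block_mat M' N (0\<^sub>m m1 (k - m1)) (0\<^sub>m m1 m1) \<and>
        m2 = vec_space.rank (k - m1) N)"

definition singular_maximal_type :: "complex mat \<Rightarrow> bool" where
  "singular_maximal_type M \<longleftrightarrow>
     square_mat M \<and> \<not> invertible_mat M \<and> off_diagonal_rank M (corank M)"


section \<open>The complex structures of the classification\<close>

text \<open>\<open>structure6 F br J\<close>: \<open>J\<close> is a complex structure with a basis \<open>\<sigma>\<^sup>1, \<sigma>\<^sup>2, \<sigma>\<^sup>3\<close> of (1,0)-forms such that
  \<open>d\<sigma>\<^sup>1 = d\<sigma>\<^sup>2 = 0\<close> and \<open>d\<sigma>\<^sup>3\<close> is the expression \<open>F\<close> in the 2-forms \<open>s j k = \<sigma>\<^sup>j \<and> cnj \<sigma>\<^sup>k\<close>, evaluated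
  on a pair of vectors.\<close>

definition structure6 ::
  "((nat \<Rightarrow> nat \<Rightarrow> complex) \<Rightarrow> complex) \<Rightarrow> ('g::real_vector \<Rightarrow> 'g \<Rightarrow> 'g) \<Rightarrow> ('g \<Rightarrow> 'g) \<Rightarrow> bool" where
  "structure6 F br J \<longleftrightarrow> complex_structure br J \<and>
     (\<exists>\<sigma>. basis10 3 J \<sigma> \<and> ce_d br (\<sigma> 1) = 0 \<and> ce_d br (\<sigma> 2) = 0 \<and>
        (\<forall>x y. ce_d br (\<sigma> 3) x y = F (\<lambda>j k. wedge_bar \<sigma> j k x y)))"

definition J_s1 :: "('g::real_vector \<Rightarrow> 'g \<Rightarrow> 'g) \<Rightarrow> ('g \<Rightarrow> 'g) \<Rightarrow> bool" where
  "J_s1 = structure6 (\<lambda>s. s 1 2)"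

definition J_320 :: "('g::real_vector \<Rightarrow> 'g \<Rightarrow> 'g) \<Rightarrow> ('g \<Rightarrow> 'g) \<Rightarrow> bool" where
  "J_320 = structure6 (\<lambda>s. s 1 1 + s 2 2)"

definition J_310 :: "('g::real_vector \<Rightarrow> 'g \<Rightarrow> 'g) \<Rightarrow> ('g \<Rightarrow> 'g) \<Rightarrow> bool" where
  "J_310 = structure6 (\<lambda>s. s 1 1 - s 2 2)"

definition J_r1 :: "('g::real_vector \<Rightarrow> 'g \<Rightarrow> 'g) \<Rightarrow> ('g \<Rightarrow> 'g) \<Rightarrow> bool" where
  "J_r1 = structure6 (\<lambda>s. s 1 2 + s 2 1 + \<i> * s 2 2)"

definition J_r2 :: "real \<Rightarrow> ('g::real_vector \<Rightarrow> 'g \<Rightarrow> 'g) \<Rightarrow> ('g \<Rightarrow> 'g) \<Rightarrow> bool" where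
  "J_r2 \<mu> = structure6 (\<lambda>s. s 1 2 + complex_of_real \<mu> * s 2 1)"

definition J_r3 :: "real \<Rightarrow> ('g::real_vector \<Rightarrow> 'g \<Rightarrow> 'g) \<Rightarrow> ('g \<Rightarrow> 'g) \<Rightarrow> bool" where
  "J_r3 \<theta> = structure6 (\<lambda>s. s 1 1 + cis \<theta> * s 2 2)"


section \<open>The Lie algebras of the classification\<close>

text \<open>The Lie algebra on \<open>\<real>\<^sup>6\<close> with \<open>de\<^sup>1 = de\<^sup>2 = de\<^sup>3 = de\<^sup>4 = 0\<close>, \<open>de\<^sup>5 = F5\<close>, \<open>de\<^sup>6 = F6\<close>, where \<open>e\<^sup>i\<close> is the
  \<open>i\<close>-th coordinate; the sign comes from \<open>(de\<^sup>i) x y = - e\<^sup>i [x, y]\<close>.\<close>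

definition salamon ::
  "(real^6 \<Rightarrow> real^6 \<Rightarrow> real) \<Rightarrow> (real^6 \<Rightarrow> real^6 \<Rightarrow> real) \<Rightarrow> real^6 \<Rightarrow> real^6 \<Rightarrow> real^6" where
  "salamon F5 F6 x y = (\<chi> i. if i = 5 then - F5 x y else if i = 6 then - F6 x y else 0)"

definition e2 :: "6 \<Rightarrow> 6 \<Rightarrow> real^6 \<Rightarrow> real^6 \<Rightarrow> real" where
  "e2 j k = wedge (\<lambda>x. x $ j) (\<lambda>x. x $ k)"

definition lie_h2 :: "real^6 \<Rightarrow> real^6 \<Rightarrow> real^6" where
  "lie_h2 = salamon (e2 1 2) (e2 3 4)"

definition lie_h3 :: "real^6 \<Rightarrow> real^6 \<Rightarrow> real^6" where
  "lie_h3 = salamon 0 (e2 1 2 + e2 3 4)"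

definition lie_h4 :: "real^6 \<Rightarrow> real^6 \<Rightarrow> real^6" where
  "lie_h4 = salamon (e2 1 2) (e2 1 4 + e2 2 3)"

definition lie_h5 :: "real^6 \<Rightarrow> real^6 \<Rightarrow> real^6" where
  "lie_h5 = salamon (e2 1 3 + e2 4 2) (e2 1 4 + e2 2 3)"


section \<open>Isomorphism\<close>

definition cs_isomorphism ::
  "('g::real_vector \<Rightarrow> 'g \<Rightarrow> 'g) \<Rightarrow> ('g \<Rightarrow> 'g) \<Rightarrow> ('h::real_vector \<Rightarrow> 'h \<Rightarrow> 'h) \<Rightarrow> ('h \<Rightarrow> 'h) \<Rightarrow> ('g \<Rightarrow> 'h) \<Rightarrow> bool"
  where
  "cs_isomorphism br J br' J' \<phi> \<longleftrightarrow> linear \<phi> \<and> bij \<phi> \<and>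
     (\<forall>x y. \<phi> (br x y) = br' (\<phi> x) (\<phi> y)) \<and> (\<forall>x. \<phi> (J x) = J' (\<phi> x))"

text \<open>\<open>(br, J)\<close> is isomorphic to the Lie algebra \<open>h\<close> with the complex structure described by the structure
  equations \<open>P\<close>, which determine it up to isomorphism.\<close>

definition isomorphic_to ::
  "('g::real_vector \<Rightarrow> 'g \<Rightarrow> 'g) \<Rightarrow> ('g \<Rightarrow> 'g) \<Rightarrow> ('h::real_vector \<Rightarrow> 'h \<Rightarrow> 'h) \<Rightarrow>
   (('h \<Rightarrow> 'h \<Rightarrow> 'h) \<Rightarrow> ('h \<Rightarrow> 'h) \<Rightarrow> bool) \<Rightarrow> bool" where
  "isomorphic_to br J h P \<longleftrightarrow> (\<exists>J' \<phi>. P h J' \<and> cs_isomorphism br J h J' \<phi>)"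

end

theory Submission
  imports Defs
begin

text \<open>
  The matrix of a structure is determined only up to \<open>M \<mapsto> k S M S\<^sup>*\<close> with \<open>k \<noteq> 0\<close> and \<open>S\<close> invertible:
  \<open>S\<close> changes the basis of the closed (1,0)-forms and \<open>k\<close> rescales the third form
  (\<open>structure6_congruent\<close>). The classification is therefore that of sesquilinear forms
  \<open>h(u, v) = u M v\<^sup>*\<close> on \<open>\<complex>\<^sup>2\<close> up to scalars.

  For a regular form, let \<open>\<kappa>\<close> be a root of the quadratic polynomial \<open>det (M - \<kappa> M\<^sup>*)\<close> and let \<open>u\<close> be in
  the left kernel of \<open>M - \<kappa> M\<^sup>*\<close>, so that \<open>h(u, w) = \<kappa> cnj (h(w, u))\<close> for all \<open>w\<close>. Left and right
  orthogonality to \<open>u\<close> are thus the same condition.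
  \<^item> If \<open>h(u, u) \<noteq> 0\<close>, the orthogonal complement of \<open>u\<close> splits off and the form is diagonal. Up to
    scalars it is \<open>diag(1, \<pm>1)\<close>, which is Hermitian, or \<open>diag(1, cis \<theta>)\<close> with \<open>0 < \<theta> < pi\<close>.
  \<^item> If \<open>u\<close> is isotropic, then in a basis \<open>u, v\<close> the matrix is \<open>(0, b; c, z)\<close> with \<open>|b| = |\<kappa>| |c|\<close>.
    If \<open>|b| \<noteq> |c|\<close>, then \<open>z\<close> can be removed by adding a multiple of \<open>u\<close> to \<open>v\<close>, which leaves
    \<open>(0, 1; \<mu>, 0)\<close> with \<open>\<mu> > 1\<close>. If \<open>|b| = |c|\<close>, only one real component of \<open>z\<close> can be removed, and the
    result is \<open>(0, 1; 1, \<i>)\<close> or the Hermitian matrix \<open>(0, 1; 1, 0)\<close>.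

  This is \<open>regular_normal_form\<close>. When no matrix of the structure is Hermitian, only the three
  non-Hermitian types are left. When the structure has a Hermitian matrix \<open>H\<close>, which need not be the
  given one, the diagonalisation applies to \<open>H\<close> once \<open>H\<close> is known to be regular; this is seen on the
  centre of the Lie algebra (\<open>hermitian_representative_regular\<close>). In the singular case of maximal type
  the block \<open>N\<close> is a nonzero number and the form becomes \<open>(0, 1; 0, 0)\<close>.

  Finally each normal form is matched with its Lie algebra by writing the three (1,0)-forms explicitly
  in the real coframe \<open>e\<^sup>1, \<dots>, e\<^sup>6\<close> and comparing structure equations. Three (1,0)-forms on a
  six-dimensional space form a basis exactly when they vanish together only at \<open>0\<close>
  (\<open>basis10_3I\<close>, \<open>basis10_3_separates\<close>), so a coframe gives a linear bijection onto \<open>\<real>\<^sup>6\<close>, along which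
  the complex structure is transported.
\<close>

section \<open>Sesquilinear forms on the complex plane up to scalars\<close>

text \<open>A two by two matrix, listed row by row.\<close>

type_synonym quad = "complex \<times> complex \<times> complex \<times> complex"

text \<open>The sesquilinear form \<open>u M v\<^sup>*\<close> of row vectors.\<close>

fun sesq :: "quad \<Rightarrow> complex \<times> complex \<Rightarrow> complex \<times> complex \<Rightarrow> complex" where
  "sesq (a, b, c, d) (p, q) (r, s) =
     a * p * cnj r + b * p * cnj s + c * q * cnj r + d * q * cnj s"

fun det2 :: "complex \<times> complex \<Rightarrow> complex \<times> complex \<Rightarrow> complex" where
  "det2 (p, q) (r, s) = p * s - q * r"

fun quad_det :: "quad \<Rightarrow> complex" where
  "quad_det (a, b, c, d) = a * d - b * c"

fun hermitian_quad :: "quad \<Rightarrow> bool" where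
  "hermitian_quad (a, b, c, d) \<longleftrightarrow> cnj a = a \<and> cnj d = d \<and> c = cnj b"

text \<open>The relation \<open>M' = k S M S\<^sup>*\<close>, where \<open>u\<close> and \<open>v\<close> are the rows of \<open>S\<close>.\<close>

definition congruent :: "quad \<Rightarrow> quad \<Rightarrow> bool" where
  "congruent m m' \<longleftrightarrow> (\<exists>k u v. k \<noteq> 0 \<and> det2 u v \<noteq> 0 \<and>
     m' = (k * sesq m u u, k * sesq m u v, k * sesq m v u, k * sesq m v v))"

lemma congruentI:
  assumes "k \<noteq> 0" "det2 u v \<noteq> 0"
    and "k * sesq m u u = a" "k * sesq m u v = b" "k * sesq m v u = c" "k * sesq m v v = d"
  shows "congruent m (a, b, c, d)"
  using assms unfolding congruent_def by blast

lemma congruent_trans: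
  assumes "congruent m m'" "congruent m' m''"
  shows "congruent m m''"
proof -
  obtain a b c d where m: "m = (a, b, c, d)" by (cases m)
  obtain k p q r s where 1: "k \<noteq> 0" "p * s - q * r \<noteq> 0"
    "m' = (k * sesq m (p, q) (p, q), k * sesq m (p, q) (r, s), k * sesq m (r, s) (p, q), k * sesq m (r, s) (r, s))"
    using assms(1) unfolding congruent_def by (metis det2.simps surj_pair)
  obtain k' p' q' r' s' where 2: "k' \<noteq> 0" "p' * s' - q' * r' \<noteq> 0"
    "m'' = (k' * sesq m' (p', q') (p', q'), k' * sesq m' (p', q') (r', s'),
            k' * sesq m' (r', s') (p', q'), k' * sesq m' (r', s') (r', s'))"
    using assms(2) unfolding congruent_def by (metis det2.simps surj_pair)
  let ?u = "(p' * p + q' * r, p' * q + q' * s)" and ?v = "(r' * p + s' * r, r' * q + s' * s)"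
  have det: "det2 ?u ?v = (p' * s' - q' * r') * (p * s - q * r)"
    by (simp add: algebra_simps)
  show ?thesis
    unfolding congruent_def
  proof (intro exI conjI)
    show "k' * k \<noteq> 0" using 1 2 by simp
    show "det2 ?u ?v \<noteq> 0" unfolding det using 1 2 by simp
    show "m'' = (k' * k * sesq m ?u ?u, k' * k * sesq m ?u ?v, k' * k * sesq m ?v ?u, k' * k * sesq m ?v ?v)"
      unfolding 2(3) 1(3) m by (simp add: algebra_simps)
  qed
qed

lemma quad_det_congruent:
  assumes "congruent m m'" "quad_det m \<noteq> 0"
  shows "quad_det m' \<noteq> 0"
proof -
  obtain a b c d where m: "m = (a, b, c, d)" by (cases m)
  obtain k p q r s where 1: "k \<noteq> 0" "p * s - q * r \<noteq> 0"
    "m' = (k * sesq m (p, q) (p, q), k * sesq m (p, q) (r, s), k * sesq m (r, s) (p, q), k * sesq m (r, s) (r, s))"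
    using assms(1) unfolding congruent_def by (metis det2.simps surj_pair)
  have "quad_det m' = k * k * ((p * s - q * r) * cnj (p * s - q * r)) * quad_det m"
    unfolding 1(3) m by (simp add: algebra_simps)
  then show ?thesis using 1 assms(2) by (simp del: complex_cnj_diff complex_cnj_mult)
qed

lemma unimodular_cnj: "cmod s = 1 \<Longrightarrow> s * cnj s = 1"
  by (simp flip: complex_norm_square)

lemma polar_square_root:
  obtains s where "cmod s = 1" "z = complex_of_real (cmod z) * (s * s)"
proof
  show "cmod (cis (Arg z / 2)) = 1" by simp
  show "z = complex_of_real (cmod z) * (cis (Arg z / 2) * cis (Arg z / 2))"
    by (simp add: cis_mult) (metis rcis_cmod_Arg rcis_def)
qed

text \<open>The scalar makes one diagonal entry \<open>1\<close>. The other entry can then be multiplied only by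
  \<open>|s|\<^sup>2 > 0\<close>, so its argument survives. Either entry may be the one that becomes \<open>1\<close>, which replaces the
  remaining phase by its conjugate.\<close>

lemma congruent_diagonal_ratio:
  assumes "a \<noteq> 0" "d \<noteq> 0"
  shows "congruent (a, 0, 0, d) (1, 0, 0, sgn (d / a))"
    and "congruent (a, 0, 0, d) (1, 0, 0, sgn (a / d))"
proof -
  define r where "r = 1 / sqrt (cmod (d / a))"
  have r: "r \<noteq> 0" "complex_of_real r * complex_of_real r = 1 / cmod (d / a)"
    using assms by (auto simp: r_def simp flip: of_real_mult)
  show "congruent (a, 0, 0, d) (1, 0, 0, sgn (d / a))"
    by (rule congruentI[where k = "1 / a" and u = "(1, 0)" and v = "(0, of_real r)"])
      (use assms r in \<open>auto simp: sgn_eq field_simps\<close>)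
  define r' where "r' = 1 / sqrt (cmod (a / d))"
  have r': "r' \<noteq> 0" "complex_of_real r' * complex_of_real r' = 1 / cmod (a / d)"
    using assms by (auto simp: r'_def simp flip: of_real_mult)
  show "congruent (a, 0, 0, d) (1, 0, 0, sgn (a / d))"
    by (rule congruentI[where k = "1 / d" and u = "(0, 1)" and v = "(of_real r', 0)"])
      (use assms r' in \<open>auto simp: sgn_eq field_simps\<close>)
qed

lemma sgn_real_complex: "z \<noteq> 0 \<Longrightarrow> Im z = 0 \<Longrightarrow> sgn z = 1 \<or> sgn z = -1"
proof -
  assume z: "z \<noteq> 0" "Im z = 0"
  then have e: "z = of_real (Re z)" by (simp add: complex_eq_iff)
  then have "Re z \<noteq> 0" using z by auto
  then show ?thesis by (subst (1 2) e) (auto simp: sgn_of_real sgn_if)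
qed

lemma sgn_upper_half_plane: "Im z > 0 \<Longrightarrow> \<exists>\<theta>. 0 < \<theta> \<and> \<theta> < pi \<and> sgn z = cis \<theta>"
proof -
  assume z: "Im z > 0"
  then have "sgn z = cis (Arg z)" by (subst cis_Arg) auto
  with z show ?thesis using Arg_lt_pi by blast
qed

text \<open>Of the two conjugate phases that \<open>congruent_diagonal_ratio\<close> offers, one lies in the upper half-plane
  unless both are real.\<close>

lemma diagonal_normal_form:
  assumes "a \<noteq> 0" "d \<noteq> 0"
  shows "congruent (a, 0, 0, d) (1, 0, 0, 1) \<or> congruent (a, 0, 0, d) (1, 0, 0, -1) \<or>
    (Im (d / a) \<noteq> 0 \<and> (\<exists>\<theta>. 0 < \<theta> \<and> \<theta> < pi \<and> congruent (a, 0, 0, d) (1, 0, 0, cis \<theta>)))"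
proof -
  note ratio = congruent_diagonal_ratio[OF assms]
  consider "Im (d / a) = 0" | "Im (d / a) > 0" | "Im (d / a) < 0" by linarith
  then show ?thesis
  proof cases
    case 1
    then show ?thesis using sgn_real_complex[of "d / a"] assms ratio(1) by force
  next
    case 2
    then show ?thesis using sgn_upper_half_plane[OF 2] ratio(1) by auto
  next
    case 3
    have "Im (inverse (d / a)) > 0"
      using 3 by (simp only: inverse_complex.simps) 
        (smt (verit) divide_pos_pos power2_less_0 zero_eq_power2 zero_le_power2)
    then have "Im (a / d) > 0" by simp
    then show ?thesis using 3 sgn_upper_half_plane[of "a / d"] ratio(2) by auto
  qed
qed

text \<open>Replacing the first basis vector \<open>u\<close> by \<open>s u\<close> with \<open>|s| = 1\<close> multiplies the ratio \<open>c / b\<close> by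
  \<open>(cnj s)\<^sup>2\<close>, so a square root of its phase makes the ratio positive.\<close>

lemma antidiagonal_phase:
  assumes "b \<noteq> 0"
  obtains k where "k \<noteq> 0" "congruent (0, b, c, z) (0, 1, complex_of_real (cmod c / cmod b), k * z)"
proof -
  obtain s where s: "cmod s = 1" "c / b = complex_of_real (cmod (c / b)) * (s * s)"
    by (rule polar_square_root)
  have "s \<noteq> 0" using s(1) by auto
  have ss: "s * cnj s = 1" by (rule unimodular_cnj[OF s(1)])
  show ?thesis
  proof (rule that)
    show "1 / (b * s) \<noteq> 0" using assms \<open>s \<noteq> 0\<close> by simp
    have "1 / (b * s) * (c * cnj s) = (c / b) * (cnj s / s)" by simp
    also have "\<dots> = complex_of_real (cmod (c / b)) * (s * cnj s)"
      using \<open>s \<noteq> 0\<close> by (subst s(2)) simp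
    finally have c: "1 / (b * s) * (c * cnj s) = of_real (cmod c / cmod b)"
      by (simp add: ss norm_divide)
    show "congruent (0, b, c, z) (0, 1, complex_of_real (cmod c / cmod b), 1 / (b * s) * z)"
      by (rule congruentI[where k = "1 / (b * s)" and u = "(s, 0)" and v = "(0, 1)"])
        (use assms \<open>s \<noteq> 0\<close> c in \<open>auto simp: field_simps\<close>)
  qed
qed

lemma antidiagonal_normal_form:
  assumes "b \<noteq> 0" "c \<noteq> 0" "cmod b \<noteq> cmod c"
  shows "\<exists>\<mu>::real. 1 < \<mu> \<and> congruent (0, b, c, 0) (0, 1, of_real \<mu>, 0)"
proof (cases "cmod b < cmod c")
  case True
  have "congruent (0, b, c, 0) (0, 1, of_real (cmod c / cmod b), 0)"
    using antidiagonal_phase[OF assms(1), of c 0] by auto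
  with True assms show ?thesis by (intro exI[of _ "cmod c / cmod b"]) simp
next
  case False
  have "congruent (0, b, c, 0) (0, c, b, 0)"
    by (rule congruentI[where k = 1 and u = "(0, 1)" and v = "(1, 0)"]) auto
  moreover have "congruent (0, c, b, 0) (0, 1, of_real (cmod b / cmod c), 0)"
    using antidiagonal_phase[OF assms(2), of b 0] by auto
  ultimately have "congruent (0, b, c, 0) (0, 1, of_real (cmod b / cmod c), 0)"
    by (rule congruent_trans)
  with False assms show ?thesis by (intro exI[of _ "cmod b / cmod c"]) simp
qed

text \<open>Replacing \<open>v\<close> by \<open>t u + v\<close> adds \<open>b t + c cnj t\<close> to the corner entry. As a real-linear map of \<open>t\<close> this
  has determinant \<open>|b|\<^sup>2 - |c|\<^sup>2\<close>, so every corner entry can be cancelled when the moduli differ.\<close>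

lemma isotropic_clear_corner:
  assumes "cmod b \<noteq> cmod c"
  shows "congruent (0, b, c, z) (0, b, c, 0)"
proof -
  define D where "D = b * cnj b - c * cnj c"
  have "D = of_real ((cmod b)\<^sup>2 - (cmod c)\<^sup>2)"
    unfolding D_def of_real_diff complex_norm_square ..
  moreover have "(cmod b)\<^sup>2 - (cmod c)\<^sup>2 \<noteq> 0"
    using assms by simp
  ultimately have D: "D \<noteq> 0" "cnj D = D"
    by (simp_all del: of_real_diff)
  \<comment> \<open>Cramer's rule for \<open>b t + c cnj t = - z\<close> together with its conjugate.\<close>
  define t where "t = (cnj z * c - z * cnj b) / D"
  have "b * t + c * cnj t = - z"
  proof -
    have "(b * t + c * cnj t) * D = b * (cnj z * c - z * cnj b) + c * (z * cnj c - cnj z * b)"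
      using D by (simp add: t_def field_simps)
    also have "\<dots> = - z * D" by (simp add: D_def algebra_simps)
    finally show ?thesis using D(1) by (metis mult_cancel_right)
  qed
  then have "sesq (0, b, c, z) (t, 1) (t, 1) = 0" by (simp add: algebra_simps)
  then show ?thesis
    by (intro congruentI[where k = 1 and u = "(1, 0)" and v = "(t, 1)"]) auto
qed

text \<open>Once \<open>b = c = 1\<close>, replacing \<open>v\<close> by \<open>t u + v\<close> changes only the real part of the corner entry. The
  imaginary part \<open>y\<close> can be rescaled by positive reals, and its sign is absorbed in the scalar.\<close>

lemma isotropic_unimodular_normal_form:
  assumes "b \<noteq> 0" "cmod b = cmod c"
  shows "congruent (0, b, c, z) (0, 1, 1, 0) \<or> congruent (0, b, c, z) (0, 1, 1, \<i>)"
proof -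
  obtain k where k: "congruent (0, b, c, z) (0, 1, complex_of_real (cmod c / cmod b), k * z)"
    by (rule antidiagonal_phase[OF assms(1)])
  define w where "w = k * z"
  define y where "y = Im w"
  have 1: "congruent (0, b, c, z) (0, 1, 1, w)"
    using k assms by (cases "c = 0") (auto simp: w_def)
  have "congruent (0, 1, 1, w) (0, 1, 1, \<i> * y)"
    by (rule congruentI[where k = 1 and u = "(1, 0)" and v = "(- of_real (Re w) / 2, 1)"])
      (auto simp: y_def complex_eq_iff)
  with 1 have 2: "congruent (0, b, c, z) (0, 1, 1, \<i> * y)" by (rule congruent_trans)
  show ?thesis
  proof (cases "y = 0")
    case True
    then show ?thesis using 2 by simp
  next
    case False
    define r where "r = sqrt \<bar>y\<bar>"
    have r: "r \<noteq> 0" "complex_of_real r * complex_of_real r = \<bar>y\<bar>"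
      using False by (auto simp: r_def simp flip: of_real_mult)
    have "congruent (0, 1, 1, \<i> * y) (0, 1, 1, \<i>)"
      by (rule congruentI[where k = "of_real (sgn y)" and u = "(of_real (sgn y * r), 0)"
            and v = "(0, of_real (1 / r))"])
        (use False r in \<open>auto simp: sgn_if field_simps\<close>)
    then show ?thesis using congruent_trans[OF 2] by blast
  qed
qed

text \<open>The eigenvector equation makes the right orthogonal complement of \<open>u\<close> also left orthogonal. Since \<open>u\<close>
  is not isotropic, this line is complementary to \<open>u\<close>.\<close>

lemma sesq_orthogonal_splitting:
  assumes m: "quad_det m \<noteq> 0" and u: "sesq m u u \<noteq> 0"
    and eig: "\<And>w. sesq m u w = \<kappa> * cnj (sesq m w u)" and "\<kappa> \<noteq> 0"
  obtains w where "sesq m w w \<noteq> 0" "congruent m (sesq m u u, 0, 0, sesq m w w)"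
proof -
  obtain a b c d where md: "m = (a, b, c, d)" by (cases m)
  obtain p q where ud: "u = (p, q)" by (cases u)
  \<comment> \<open>The vector, unique up to scalars, with \<open>h(u, w) = 0\<close>.\<close>
  define w where "w = (cnj (b * p + d * q), - cnj (a * p + c * q))"
  have uw: "sesq m u w = 0" by (simp add: md ud w_def algebra_simps)
  then have wu: "sesq m w u = 0" using eig[of w] \<open>\<kappa> \<noteq> 0\<close> by simp
  have "det2 u w = - cnj (sesq m u u)" by (simp add: md ud w_def algebra_simps)
  then have det: "det2 u w \<noteq> 0" using u by simp
  have cong: "congruent m (sesq m u u, 0, 0, sesq m w w)"
    by (rule congruentI[where k = 1 and u = u and v = w]) (use uw wu det in auto)
  with quad_det_congruent[OF this m] show ?thesis by (intro that) auto
qed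

lemma singular_left_kernel:
  fixes e f g h :: complex
  assumes "e * h - f * g = 0"
  obtains p q where "(p, q) \<noteq> (0, 0)" "e * p + g * q = 0" "f * p + h * q = 0"
proof (cases "e = 0 \<and> g = 0")
  case True
  then show ?thesis using that[of h "- f"] that[of 1 0] assms by (cases "h = 0 \<and> f = 0") auto
next
  case False
  then show ?thesis using that[of g "- e"] assms by (auto simp: algebra_simps)
qed

lemma complex_quadratic_root:
  fixes A B C :: complex
  assumes "A \<noteq> 0"
  obtains x where "A * x\<^sup>2 + B * x + C = 0"
proof
  define D where "D = csqrt (B\<^sup>2 - 4 * A * C)"
  have D: "D\<^sup>2 = B\<^sup>2 - 4 * A * C" by (simp add: D_def)
  have "4 * A * (A * ((D - B) / (2 * A))\<^sup>2 + B * ((D - B) / (2 * A)) + C) = D\<^sup>2 - (B\<^sup>2 - 4 * A * C)"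
    using assms by (simp add: field_simps power2_eq_square)
  then show "A * ((D - B) / (2 * A))\<^sup>2 + B * ((D - B) / (2 * A)) + C = 0"
    using assms D by simp
qed

text \<open>The vector \<open>u\<close> is in the left kernel of \<open>M - \<kappa> M\<^sup>*\<close>. The polynomial \<open>det (M - \<kappa> M\<^sup>*)\<close> has leading
  coefficient \<open>cnj (det M)\<close> and constant term \<open>det M\<close>, so for regular \<open>M\<close> it has a root, and the root is
  nonzero.\<close>

lemma cosquare_eigenvector:
  assumes "quad_det m \<noteq> 0"
  obtains \<kappa> u where "\<kappa> \<noteq> 0" "u \<noteq> (0, 0)" "\<And>w. sesq m u w = \<kappa> * cnj (sesq m w u)"
proof -
  obtain a b c d where m: "m = (a, b, c, d)" by (cases m)
  let ?\<Delta> = "a * d - b * c"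
  have \<Delta>: "?\<Delta> \<noteq> 0" using assms m by simp
  then have "cnj ?\<Delta> \<noteq> 0" by (simp del: complex_cnj_diff)
  then obtain \<kappa> where \<kappa>: "cnj ?\<Delta> * \<kappa>\<^sup>2 + (b * cnj b + c * cnj c - a * cnj d - cnj a * d) * \<kappa> + ?\<Delta> = 0"
    by (rule complex_quadratic_root)
  then have "\<kappa> \<noteq> 0" using \<Delta> by auto
  have "(a - \<kappa> * cnj a) * (d - \<kappa> * cnj d) - (b - \<kappa> * cnj c) * (c - \<kappa> * cnj b) = 0"
    using \<kappa> by (simp add: algebra_simps power2_eq_square)
  then obtain p q where pq: "(p, q) \<noteq> (0, 0)"
    "(a - \<kappa> * cnj a) * p + (c - \<kappa> * cnj b) * q = 0" "(b - \<kappa> * cnj c) * p + (d - \<kappa> * cnj d) * q = 0"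
    by (rule singular_left_kernel)
  have "sesq m (p, q) w = \<kappa> * cnj (sesq m w (p, q))" for w
  proof -
    obtain r s where w: "w = (r, s)" by (cases w)
    have "sesq m (p, q) w - \<kappa> * cnj (sesq m w (p, q)) =
      ((a - \<kappa> * cnj a) * p + (c - \<kappa> * cnj b) * q) * cnj r +
      ((b - \<kappa> * cnj c) * p + (d - \<kappa> * cnj d) * q) * cnj s"
      by (simp add: m w algebra_simps)
    then show ?thesis by (simp add: pq)
  qed
  with \<open>\<kappa> \<noteq> 0\<close> pq(1) show ?thesis by (rule that)
qed

text \<open>The case distinction is on whether the eigenvector \<open>u\<close> is isotropic; if it is, then the moduli of
  \<open>h(u, v)\<close> and \<open>h(v, u)\<close> decide.\<close>

lemma regular_normal_form:
  assumes "quad_det m \<noteq> 0"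
  shows "(\<exists>h. hermitian_quad h \<and> congruent m h) \<or> congruent m (0, 1, 1, \<i>) \<or>
    (\<exists>\<mu>::real. 1 < \<mu> \<and> congruent m (0, 1, of_real \<mu>, 0)) \<or>
    (\<exists>\<theta>. 0 < \<theta> \<and> \<theta> < pi \<and> congruent m (1, 0, 0, cis \<theta>))"
proof -
  obtain \<kappa> u where \<kappa>: "\<kappa> \<noteq> 0" and u: "u \<noteq> (0, 0)"
    and eig: "\<And>w. sesq m u w = \<kappa> * cnj (sesq m w u)"
    by (rule cosquare_eigenvector[OF assms]) blast
  show ?thesis
  proof (cases "sesq m u u = 0")
    case False
    then obtain w where w: "sesq m w w \<noteq> 0" "congruent m (sesq m u u, 0, 0, sesq m w w)"
      using sesq_orthogonal_splitting[OF assms _ eig \<kappa>] by metis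
    have "hermitian_quad (1, 0, 0, 1)" "hermitian_quad (1, 0, 0, -1)" by auto
    then show ?thesis
      using diagonal_normal_form[OF False w(1)] congruent_trans[OF w(2)] by blast
  next
    case True
    obtain p q where pq: "u = (p, q)" by (cases u)
    \<comment> \<open>Any vector independent of \<open>u\<close> would do; here the determinant is \<open>|p|\<^sup>2 + |q|\<^sup>2\<close>.\<close>
    define v where "v = (- cnj q, cnj p)"
    have "det2 u v = of_real ((cmod p)\<^sup>2 + (cmod q)\<^sup>2)"
      unfolding of_real_add complex_norm_square by (simp add: pq v_def)
    then have det: "det2 u v \<noteq> 0"
      using u pq by (simp del: of_real_add add: sum_power2_eq_zero_iff)
    let ?b = "sesq m u v" and ?c = "sesq m v u" and ?z = "sesq m v v"
    have cong: "congruent m (0, ?b, ?c, ?z)"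
      by (rule congruentI[where k = 1 and u = u and v = v]) (use True det in auto)
    with quad_det_congruent[OF this assms] have bc: "?b \<noteq> 0" "?c \<noteq> 0" by auto
    show ?thesis
    proof (cases "cmod ?b = cmod ?c")
      case True
      have "hermitian_quad (0, 1, 1, 0)" by simp
      then show ?thesis
        using isotropic_unimodular_normal_form[OF bc(1) True, of ?z] congruent_trans[OF cong] by blast
    next
      case False
      from congruent_trans[OF cong isotropic_clear_corner[OF False]]
      have "congruent m (0, ?b, ?c, 0)" .
      then show ?thesis
        using antidiagonal_normal_form[OF bc False] congruent_trans by blast
    qed
  qed
qed

text \<open>A Hermitian form satisfies the eigenvector equation with \<open>\<kappa> = 1\<close> for every \<open>u\<close>, and polarisation gives
  one that is not isotropic. All values \<open>h(u, u)\<close> are real, so the diagonal entries have a real ratio.\<close>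

lemma hermitian_normal_form:
  assumes "quad_det m \<noteq> 0" "hermitian_quad m"
  shows "congruent m (1, 0, 0, 1) \<or> congruent m (1, 0, 0, -1)"
proof -
  obtain a b c d where m: "m = (a, b, c, d)" by (cases m)
  have herm: "cnj a = a" "cnj d = d" "c = cnj b" using assms(2) m by auto
  have eig: "sesq m u w = 1 * cnj (sesq m w u)" for u w
    using herm by (cases u; cases w) (simp add: m algebra_simps)
  have real: "Im (sesq m u u) = 0" for u
    using eig[of u u] by (simp add: complex_eq_iff)
  have "\<exists>u. sesq m u u \<noteq> 0"
  proof (rule ccontr)
    assume "\<not> (\<exists>u. sesq m u u \<noteq> 0)"
    then have 0: "sesq m u u = 0" for u by blast
    have "a = 0" "d = 0" using 0[of "(1, 0)"] 0[of "(0, 1)"] by (auto simp: m)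
    \<comment> \<open>With \<open>a = d = 0\<close> the value at \<open>(1, b)\<close> is \<open>2 |b|\<^sup>2\<close>.\<close>
    moreover have "b = 0" using 0[of "(1, b)"] \<open>a = 0\<close> \<open>d = 0\<close> by (simp add: m herm)
    ultimately show False using assms(1) m by simp
  qed
  then obtain u where u: "sesq m u u \<noteq> 0" by blast
  obtain w where w: "sesq m w w \<noteq> 0" "congruent m (sesq m u u, 0, 0, sesq m w w)"
    using sesq_orthogonal_splitting[OF assms(1) u eig] by auto
  have "Im (sesq m w w / sesq m u u) = 0" using real by (simp add: Im_divide)
  then show ?thesis
    using diagonal_normal_form[OF u w(1)] congruent_trans[OF w(2)] by blast
qed

lemma singular_row_normal_form:
  assumes "b \<noteq> 0"
  shows "congruent (a, b, 0, 0) (0, 1, 0, 0)"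
  by (rule congruentI[where k = "1 / b" and u = "(1, - cnj (a / b))" and v = "(0, 1)"])
    (use assms in auto)

section \<open>Bases of (1,0)-forms in real dimension six\<close>

text \<open>Forms are indexed by \<open>1\<close>, \<open>2\<close>, \<open>3\<close>; keeping the literal \<open>1\<close> lets facts about \<open>\<sigma> 1\<close> apply as rewrite
  rules.\<close>

declare One_nat_def [simp del]

lemma linear_injective_imp_bij:
  fixes f :: "'a::real_vector \<Rightarrow> 'b::euclidean_space"
  assumes "linear f" "\<And>x. f x = 0 \<Longrightarrow> x = 0" "dim (UNIV :: 'a set) = DIM('b)"
  shows "bij f"
proof -
  have inj: "inj f"
    using linear_injective_0[OF assms(1)] assms(2) by blast
  obtain B :: "'a set" where B: "independent B" "UNIV \<subseteq> span B" "card B = dim (UNIV :: 'a set)"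
    by (rule basis_exists[of "UNIV :: 'a set"])
  have "independent (f ` B)"
    using linear_independent_injective_image[OF assms(1) B(1)] inj by (simp add: inj_on_subset)
  then have "dim (f ` B) = DIM('b)"
    using dim_eq_card_independent inj B(3) assms(3) by (metis card_image inj_on_subset subset_UNIV)
  then have "span (f ` B) = UNIV"
    by (simp only: dim_eq_full)
  then have "range f = UNIV"
    using linear_span_image[OF assms(1), of B] B(2) by (simp add: top.extremum_unique)
  then show ?thesis
    using inj by (simp add: bij_def)
qed

lemma complex_structureD:
  assumes "complex_structure br J"
  shows "linear J" "J (J x) = - x"
  using assms unfolding complex_structure_def by auto

lemma forms10D:
  assumes "\<alpha> \<in> forms10 J"
  shows "linear \<alpha>" "\<alpha> (J x) = \<i> * \<alpha> x"
  using assms unfolding forms10_def by auto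

lemma forms10_add:
  assumes "\<alpha> \<in> forms10 J"
  shows "\<alpha> (x + y) = \<alpha> x + \<alpha> y"
  by (rule linear_add[OF forms10D(1)[OF assms]])

lemma forms10_scale:
  assumes "\<alpha> \<in> forms10 J"
  shows "\<alpha> (t *\<^sub>R x) = complex_of_real t * \<alpha> x"
  by (simp add: linear_scale[OF forms10D(1)[OF assms]] scaleR_conv_of_real)

lemma forms10I:
  assumes "\<And>x y. \<alpha> (x + y) = \<alpha> x + \<alpha> y" "\<And>t x. \<alpha> (t *\<^sub>R x) = complex_of_real t * \<alpha> x"
    and "\<And>x. \<alpha> (J x) = \<i> * \<alpha> x"
  shows "\<alpha> \<in> forms10 J"
  unfolding forms10_def using assms by (auto intro: linearI simp: scaleR_conv_of_real)

text \<open>If \<open>f\<close> is a real functional, then \<open>y \<mapsto> f y - \<i> f (J y)\<close> is a form of type (1,0) with real part \<open>f\<close>, and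
  real functionals separate points.\<close>

lemma forms10_separates_points:
  fixes J :: "'g::real_vector \<Rightarrow> 'g"
  assumes J: "linear J" "\<And>x. J (J x) = - x" and x: "\<And>\<alpha>. \<alpha> \<in> forms10 J \<Longrightarrow> \<alpha> x = 0"
  shows "x = 0"
proof (rule ccontr)
  assume "x \<noteq> 0"
  then have "independent {x}" by simp
  from linear_independent_extend[OF this, of "\<lambda>_. 1 :: real"]
  obtain f :: "'g \<Rightarrow> real" where f: "linear f" "f x = 1" by auto
  let ?\<alpha> = "\<lambda>y. Complex (f y) (- f (J y))"
  have "?\<alpha> \<in> forms10 J"
    by (rule forms10I; simp add: complex_eq_iff J(2) linear_add[OF J(1)] linear_scale[OF J(1)]
        linear_add[OF f(1)] linear_scale[OF f(1)] linear_neg[OF f(1)])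
  from x[OF this] f show False by (simp add: complex_eq_iff)
qed

lemma basis10_in_forms10: "basis10 n J \<sigma> \<Longrightarrow> i \<in> {1..n} \<Longrightarrow> \<sigma> i \<in> forms10 J"
  unfolding basis10_def using cform.span_base[of "\<sigma> i" "\<sigma> ` {1..n}"] by (metis imageI)

lemma basis10_3_separates:
  assumes "linear J" "\<And>x. J (J x) = - x" "basis10 3 J \<sigma>"
    and "\<sigma> 1 x = 0" "\<sigma> 2 x = 0" "\<sigma> 3 x = 0"
  shows "x = 0"
proof (rule forms10_separates_points[OF assms(1,2)])
  fix \<alpha> assume "\<alpha> \<in> forms10 J"
  then have "\<alpha> \<in> cform.span (\<sigma> ` {1..3})" using assms(3) by (simp add: basis10_def)
  then show "\<alpha> x = 0"
  proof (induction rule: cform.span_induct)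
    case base
    show ?case by (auto simp: cform.subspace_def cscale_def)
  next
    case (step \<beta>)
    moreover have "{1..3} = {1, 2, 3::nat}" by auto
    ultimately show ?case using assms(4-6) by auto
  qed
qed

text \<open>An injective real-linear map from a space of dimension six to \<open>\<complex>\<^sup>3\<close> is surjective.\<close>

lemma separating_forms_coordinates:
  fixes J :: "'g::real_vector \<Rightarrow> 'g"
  assumes dim: "dim (UNIV :: 'g set) = 6"
    and \<sigma>: "\<sigma> 1 \<in> forms10 J" "\<sigma> 2 \<in> forms10 J" "\<sigma> 3 \<in> forms10 J"
    and sep: "\<And>x. \<sigma> 1 x = 0 \<Longrightarrow> \<sigma> 2 x = 0 \<Longrightarrow> \<sigma> (3::nat) x = 0 \<Longrightarrow> x = 0"
  obtains x where "\<sigma> 1 x = a" "\<sigma> 2 x = b" "\<sigma> 3 x = c"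
proof -
  let ?f = "\<lambda>x. (\<sigma> 1 x, \<sigma> 2 x, \<sigma> 3 x)"
  have "bij ?f"
  proof (rule linear_injective_imp_bij)
    show "linear ?f"
      by (rule linearI) (simp_all add: \<sigma>[THEN forms10_add] \<sigma>[THEN forms10_scale] scaleR_conv_of_real)
    show "?f x = 0 \<Longrightarrow> x = 0" for x using sep[of x] by (auto simp: zero_prod_def)
    show "dim (UNIV :: 'g set) = DIM(complex \<times> complex \<times> complex)" using dim by simp
  qed
  then have "(a, b, c) \<in> range ?f" by (simp only: bij_is_surj UNIV_I)
  then obtain x where "(a, b, c) = ?f x" by (rule rangeE)
  then show ?thesis using that by auto
qed

text \<open>The vectors \<open>z1\<close>, \<open>z2\<close>, \<open>z3\<close> dual to the three forms give independence, and they express a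
  (1,0)-form \<open>\<alpha>\<close> as \<open>\<alpha> z1 \<sigma>\<^sup>1 + \<alpha> z2 \<sigma>\<^sup>2 + \<alpha> z3 \<sigma>\<^sup>3\<close>.\<close>

lemma basis10_3I:
  fixes J :: "'g::real_vector \<Rightarrow> 'g"
  assumes dim: "dim (UNIV :: 'g set) = 6" and J: "linear J"
    and \<sigma>: "\<sigma> 1 \<in> forms10 J" "\<sigma> 2 \<in> forms10 J" "\<sigma> 3 \<in> forms10 J"
    and sep: "\<And>x. \<sigma> 1 x = 0 \<Longrightarrow> \<sigma> 2 x = 0 \<Longrightarrow> \<sigma> 3 x = 0 \<Longrightarrow> x = 0"
  shows "basis10 3 J \<sigma>"
proof -
  have I: "{1..3} = {1, 2, 3::nat}" by auto
  note coords = separating_forms_coordinates[OF dim \<sigma> sep]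
  obtain z1 where z1: "\<sigma> 1 z1 = 1" "\<sigma> 2 z1 = 0" "\<sigma> 3 z1 = 0" by (rule coords)
  obtain z2 where z2: "\<sigma> 1 z2 = 0" "\<sigma> 2 z2 = 1" "\<sigma> 3 z2 = 0" by (rule coords)
  obtain z3 where z3: "\<sigma> 1 z3 = 0" "\<sigma> 2 z3 = 0" "\<sigma> 3 z3 = 1" by (rule coords)
  have ne: "\<sigma> 1 \<noteq> \<sigma> 2" "\<sigma> 1 \<noteq> \<sigma> 3" "\<sigma> 2 \<noteq> \<sigma> 3"
    using z1 z2 z3 by (metis zero_neq_one)+
  have "inj_on \<sigma> {1..3}" unfolding I using ne by (auto simp: inj_on_def)
  moreover have "cform.independent (\<sigma> ` {1..3})"
  proof
    assume "cform.dependent (\<sigma> ` {1..3})"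
    then obtain u v where u: "v \<in> \<sigma> ` {1..3}" "u v \<noteq> 0" "(\<Sum>v\<in>\<sigma> ` {1..3}. cscale (u v) v) = 0"
      using cform.dependent_finite[of "\<sigma> ` {1..3}"] by auto
    then have "cscale (u (\<sigma> 1)) (\<sigma> 1) + cscale (u (\<sigma> 2)) (\<sigma> 2) + cscale (u (\<sigma> 3)) (\<sigma> 3) = 0"
      unfolding I using ne by (simp add: add.assoc)
    then have "u (\<sigma> 1) * \<sigma> 1 x + u (\<sigma> 2) * \<sigma> 2 x + u (\<sigma> 3) * \<sigma> 3 x = 0" for x
      by (auto simp: cscale_def fun_eq_iff)
    from this[of z1] this[of z2] this[of z3] u(1,2) z1 z2 z3 show False
      unfolding I by auto
  qed
  moreover have "cform.span (\<sigma> ` {1..3}) = forms10 J"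
  proof
    have "cform.subspace (forms10 J)"
      unfolding cform.subspace_def cscale_def
      by (auto intro!: forms10I simp: forms10_add forms10_scale forms10D(2) algebra_simps)
    then show "cform.span (\<sigma> ` {1..3}) \<subseteq> forms10 J"
      by (rule cform.span_minimal[rotated]) (use \<sigma> I in auto)
    show "forms10 J \<subseteq> cform.span (\<sigma> ` {1..3})"
    proof
      fix \<alpha> assume \<alpha>: "\<alpha> \<in> forms10 J"
      have pointwise: "\<alpha> x = \<alpha> z1 * \<sigma> 1 x + \<alpha> z2 * \<sigma> 2 x + \<alpha> z3 * \<sigma> 3 x" for x
      proof -
        \<comment> \<open>Multiplication of the vector \<open>z\<close> by the complex number \<open>w\<close>, with \<open>J\<close> in the role of \<open>\<i>\<close>.\<close>
        let ?L = "\<lambda>z w. Re w *\<^sub>R z + Im w *\<^sub>R J z"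
        let ?y = "?L z1 (\<sigma> 1 x) + ?L z2 (\<sigma> 2 x) + ?L z3 (\<sigma> 3 x)"
        have L: "\<beta> (?L z w) = w * \<beta> z" if "\<beta> \<in> forms10 J" for \<beta> z w
          by (simp add: forms10_add[OF that] forms10_scale[OF that] forms10D(2)[OF that] complex_eq_iff)
        have split: "\<beta> ?y = \<sigma> 1 x * \<beta> z1 + \<sigma> 2 x * \<beta> z2 + \<sigma> 3 x * \<beta> z3" if "\<beta> \<in> forms10 J" for \<beta>
        proof -
          have "\<beta> ?y = \<beta> (?L z1 (\<sigma> 1 x)) + \<beta> (?L z2 (\<sigma> 2 x)) + \<beta> (?L z3 (\<sigma> 3 x))"
            by (simp only: forms10_add[OF that])
          then show ?thesis by (simp only: L[OF that])
        qed
        have "x - ?y = 0"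
          by (rule sep; simp only: linear_diff[OF forms10D(1)[OF \<sigma>(1)]] linear_diff[OF forms10D(1)[OF \<sigma>(2)]]
              linear_diff[OF forms10D(1)[OF \<sigma>(3)]] split[OF \<sigma>(1)] split[OF \<sigma>(2)] split[OF \<sigma>(3)] z1 z2 z3; simp)
        then have "\<alpha> x = \<alpha> ?y" by simp
        then show ?thesis unfolding split[OF \<alpha>] by (simp add: mult.commute)
      qed
      have "\<alpha> = cscale (\<alpha> z1) (\<sigma> 1) + cscale (\<alpha> z2) (\<sigma> 2) + cscale (\<alpha> z3) (\<sigma> 3)"
        by (intro ext) (subst pointwise, simp add: cscale_def)
      also have "\<dots> \<in> cform.span (\<sigma> ` {1..3})"
        unfolding I by (intro cform.span_add cform.span_scale cform.span_base) auto
      finally show "\<alpha> \<in> cform.span (\<sigma> ` {1..3})" .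
    qed
  qed
  ultimately show ?thesis unfolding basis10_def by blast
qed

lemma basis10_3_coordinates:
  fixes J :: "'g::real_vector \<Rightarrow> 'g"
  assumes "dim (UNIV :: 'g set) = 6" "linear J" "\<And>x. J (J x) = - x" "basis10 3 J \<sigma>"
  obtains x where "\<sigma> 1 x = a" "\<sigma> 2 x = b" "\<sigma> 3 x = c"
proof (rule separating_forms_coordinates[OF assms(1)])
  show "\<sigma> 1 \<in> forms10 J" "\<sigma> 2 \<in> forms10 J" "\<sigma> 3 \<in> forms10 J"
    using basis10_in_forms10[OF assms(4)] by auto
  show "x = 0" if "\<sigma> 1 x = 0" "\<sigma> 2 x = 0" "\<sigma> 3 x = 0" for x
    by (rule basis10_3_separates[OF assms(2-4) that])
qed (rule that)

section \<open>Change of basis and transport of structure equations\<close>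

fun quad_eval :: "quad \<Rightarrow> (nat \<Rightarrow> nat \<Rightarrow> complex) \<Rightarrow> complex" where
  "quad_eval (a, b, c, d) s = a * s 1 1 + b * s 1 2 + c * s 2 1 + d * s 2 2"

text \<open>If \<open>S\<close> has rows \<open>(p, q)\<close> and \<open>(r, s)\<close>, then the new forms \<open>\<tau>\<close> are defined by expressing \<open>(\<sigma>\<^sup>1, \<sigma>\<^sup>2)\<close>
  through the transpose of \<open>S\<close>; substituting this in the equation for \<open>\<sigma>\<^sup>3\<close> turns \<open>M\<close> into \<open>S M S\<^sup>*\<close>.\<close>

lemma structure6_congruent:
  fixes J :: "'g::real_vector \<Rightarrow> 'g"
  assumes dim: "dim (UNIV :: 'g set) = 6"
    and str: "structure6 (quad_eval m) br J" and cong: "congruent m m'"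
  shows "structure6 (quad_eval m') br J"
proof -
  obtain a b c d where m: "m = (a, b, c, d)" by (cases m)
  obtain k p q r s where k: "k \<noteq> 0" "p * s - q * r \<noteq> 0"
    and m': "m' = (k * sesq m (p, q) (p, q), k * sesq m (p, q) (r, s), k * sesq m (r, s) (p, q), k * sesq m (r, s) (r, s))"
    using cong unfolding congruent_def by (metis det2.simps surj_pair)
  obtain \<sigma> where cs: "complex_structure br J" and \<sigma>: "basis10 3 J \<sigma>"
    "ce_d br (\<sigma> 1) = 0" "ce_d br (\<sigma> 2) = 0"
    "\<And>x y. ce_d br (\<sigma> 3) x y = quad_eval m (\<lambda>j k. wedge_bar \<sigma> j k x y)"
    using str unfolding structure6_def by blast
  have f: "\<sigma> 1 \<in> forms10 J" "\<sigma> 2 \<in> forms10 J" "\<sigma> 3 \<in> forms10 J"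
    using basis10_in_forms10[OF \<sigma>(1)] by auto
  note J = complex_structureD[OF cs]
  define \<Delta> where "\<Delta> = p * s - q * r"
  define \<tau> :: "nat \<Rightarrow> 'g \<Rightarrow> complex" where
    "\<tau> i x = (if i = 1 then (s * \<sigma> 1 x - r * \<sigma> 2 x) / \<Delta>
              else if i = 2 then (p * \<sigma> 2 x - q * \<sigma> 1 x) / \<Delta> else k * \<sigma> 3 x)" for i x
  have \<Delta>: "\<Delta> \<noteq> 0" using k by (simp add: \<Delta>_def)
  have old: "\<sigma> 1 x = p * \<tau> 1 x + r * \<tau> 2 x" "\<sigma> 2 x = q * \<tau> 1 x + s * \<tau> 2 x" for x
    using \<Delta> by (simp_all add: \<tau>_def field_simps) (simp_all add: \<Delta>_def algebra_simps)
  have \<tau>f: "\<tau> i \<in> forms10 J" for i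
    unfolding \<tau>_def
    by (rule forms10I) (simp_all add: f[THEN forms10_add] f[THEN forms10_scale] f[THEN forms10D(2)]
        \<Delta> field_simps)
  have "basis10 3 J \<tau>"
  proof (rule basis10_3I[OF dim J(1) \<tau>f \<tau>f \<tau>f])
    fix x assume 0: "\<tau> 1 x = 0" "\<tau> 2 x = 0" "\<tau> 3 x = 0"
    have "\<sigma> 3 x = 0" using 0(3) k(1) by (simp add: \<tau>_def)
    then show "x = 0"
      by (intro basis10_3_separates[OF J \<sigma>(1)]) (simp_all only: old 0 mult_zero_right add_0)
  qed
  moreover have "ce_d br (\<tau> 1) = 0" "ce_d br (\<tau> 2) = 0"
    using \<sigma>(2,3) by (auto simp: ce_d_def fun_eq_iff \<tau>_def)
  moreover have "ce_d br (\<tau> 3) x y = quad_eval m' (\<lambda>j k. wedge_bar \<tau> j k x y)" for x y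
  proof -
    have "ce_d br (\<tau> 3) x y = k * ce_d br (\<sigma> 3) x y" by (simp add: ce_d_def \<tau>_def)
    also have "\<dots> = quad_eval m' (\<lambda>j k. wedge_bar \<tau> j k x y)"
      unfolding \<sigma>(4) by (simp add: m m' wedge_bar_def wedge_def cnj_form_def old algebra_simps)
    finally show ?thesis .
  qed
  ultimately show ?thesis unfolding structure6_def using cs by blast
qed

text \<open>The (1,0)-forms and the structure equations are pulled back along the inverse isomorphism.\<close>

lemma structure6_isomorphism:
  fixes J :: "'g::real_vector \<Rightarrow> 'g" and J' :: "'h::real_vector \<Rightarrow> 'h"
  assumes dim: "dim (UNIV :: 'h set) = 6"
    and str: "structure6 F br J" and iso: "cs_isomorphism br J br' J' \<phi>"
  shows "structure6 F br' J'"
proof -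
  have lin: "linear \<phi>" and bij: "bij \<phi>" and br: "\<And>x y. \<phi> (br x y) = br' (\<phi> x) (\<phi> y)"
    and J\<phi>: "\<And>x. \<phi> (J x) = J' (\<phi> x)"
    using iso unfolding cs_isomorphism_def by auto
  define \<psi> where "\<psi> = inv_into UNIV \<phi>"
  have \<psi>\<phi>: "\<psi> (\<phi> x) = x" and \<phi>\<psi>: "\<phi> (\<psi> y) = y" for x y
    using bij by (simp_all add: \<psi>_def bij_is_inj bij_is_surj surj_f_inv_f)
  have inj: "x = y" if "\<phi> x = \<phi> y" for x y
    using bij that by (auto simp: bij_def dest: injD)
  have lin\<psi>: "linear \<psi>"
  proof (rule linearI)
    show "\<psi> (x + y) = \<psi> x + \<psi> y" for x y
      by (rule inj) (simp add: linear_add[OF lin] \<phi>\<psi>)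
    show "\<psi> (t *\<^sub>R x) = t *\<^sub>R \<psi> x" for t x
      by (rule inj) (simp add: linear_scale[OF lin] \<phi>\<psi>)
  qed
  obtain \<sigma> where cs: "complex_structure br J" and \<sigma>: "basis10 3 J \<sigma>"
    "ce_d br (\<sigma> 1) = 0" "ce_d br (\<sigma> 2) = 0"
    "\<And>x y. ce_d br (\<sigma> 3) x y = F (\<lambda>j k. wedge_bar \<sigma> j k x y)"
    using str unfolding structure6_def by blast
  note J = complex_structureD[OF cs]
  have J': "J' y = \<phi> (J (\<psi> y))" for y by (simp add: J\<phi> \<phi>\<psi>)
  have br': "br' x y = \<phi> (br (\<psi> x) (\<psi> y))" for x y by (simp add: br \<phi>\<psi>)
  have linJ': "linear J'"
    unfolding J' using linear_compose[OF linear_compose[OF lin\<psi> J(1)] lin] by (simp add: comp_def J'[abs_def])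
  have cs': "complex_structure br' J'"
    unfolding complex_structure_def
  proof (intro conjI allI)
    show "linear J'" by (rule linJ')
    show "J' (J' x) = - x" for x
      by (simp add: J' \<psi>\<phi> J \<phi>\<psi> linear_neg[OF lin])
    fix x y
    have "br (J (\<psi> x)) (J (\<psi> y)) - br (\<psi> x) (\<psi> y) - J (br (J (\<psi> x)) (\<psi> y) + br (\<psi> x) (J (\<psi> y))) = 0"
      using cs unfolding complex_structure_def by blast
    from arg_cong[OF this, of \<phi>]
    show "br' (J' x) (J' y) - br' x y - J' (br' (J' x) y + br' x (J' y)) = 0"
      by (simp add: linear_diff[OF lin] linear_add[OF lin] linear_0[OF lin] br J\<phi> \<phi>\<psi>)
  qed
  define \<tau> where "\<tau> i = \<sigma> i \<circ> \<psi>" for i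
  have f: "\<tau> i \<in> forms10 J'" if "i \<in> {1..3}" for i
    using basis10_in_forms10[OF \<sigma>(1) that] linear_compose[OF lin\<psi>]
    by (auto simp: forms10_def \<tau>_def J' \<psi>\<phi>)
  have "basis10 3 J' \<tau>"
  proof (rule basis10_3I[OF dim linJ'])
    fix x assume "\<tau> 1 x = 0" "\<tau> 2 x = 0" "\<tau> 3 x = 0"
    then have "\<psi> x = 0"
      by (intro basis10_3_separates[OF J \<sigma>(1)]) (auto simp: \<tau>_def)
    then show "x = 0" using \<phi>\<psi>[of x] linear_0[OF lin] by simp
  qed (use f in auto)
  moreover have "ce_d br' (\<tau> i) x y = ce_d br (\<sigma> i) (\<psi> x) (\<psi> y)" for i x y
    by (simp add: ce_d_def \<tau>_def br' \<psi>\<phi>)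
  moreover have "wedge_bar \<tau> j k x y = wedge_bar \<sigma> j k (\<psi> x) (\<psi> y)" for j k x y
    by (simp add: wedge_bar_def wedge_def cnj_form_def \<tau>_def)
  ultimately show ?thesis
    unfolding structure6_def using cs' \<sigma>(2-4) by (intro conjI exI[of _ \<tau>]) (auto simp: fun_eq_iff)
qed

lemma exhaust_6: "(x::6) = 1 \<or> x = 2 \<or> x = 3 \<or> x = 4 \<or> x = 5 \<or> x = 6"
proof (induct x)
  case (of_int z)
  then have "z = 0 \<or> z = 1 \<or> z = 2 \<or> z = 3 \<or> z = 4 \<or> z = 5" by fastforce
  then show ?case by auto
qed

lemma forall_6: "(\<forall>i::6. P i) \<longleftrightarrow> P 1 \<and> P 2 \<and> P 3 \<and> P 4 \<and> P 5 \<and> P 6"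
  by (metis exhaust_6)

definition vec6 :: "real \<Rightarrow> real \<Rightarrow> real \<Rightarrow> real \<Rightarrow> real \<Rightarrow> real \<Rightarrow> real^6" where
  "vec6 a b c d e f = (\<chi> i. if i = 1 then a else if i = 2 then b else if i = 3 then c
     else if i = 4 then d else if i = 5 then e else f)"

lemma vec6_nth [simp]:
  "vec6 a b c d e f $ 1 = a" "vec6 a b c d e f $ 2 = b" "vec6 a b c d e f $ 3 = c"
  "vec6 a b c d e f $ 4 = d" "vec6 a b c d e f $ 5 = e" "vec6 a b c d e f $ 6 = f"
  by (simp_all add: vec6_def)

text \<open>An isomorphism is prescribed by a real coframe \<open>L\<close>, given as a function of the values of the three
  forms. The vector \<open>v\<close> in \<open>hom\<close> holds the values of the forms on the bracket: the first two are closed,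
  and the third is \<open>- d\<sigma>\<^sup>3\<close>.\<close>

lemma isomorphic_to_structure6I:
  fixes J :: "'g::real_vector \<Rightarrow> 'g" and L :: "(nat \<Rightarrow> complex) \<Rightarrow> real^6"
  assumes dim: "dim (UNIV :: 'g set) = 6" and str: "structure6 (quad_eval m) br J"
    and add: "\<And>z w. L (\<lambda>i. z i + w i) = L z + L w"
    and scale: "\<And>t z. L (\<lambda>i. t *\<^sub>R z i) = t *\<^sub>R L z"
    and ker: "\<And>z. L z = 0 \<Longrightarrow> z 1 = 0 \<and> z 2 = 0 \<and> z 3 = 0"
    and hom: "\<And>z w v. v 1 = 0 \<Longrightarrow> v 2 = 0 \<Longrightarrow>
      v 3 = - quad_eval m (\<lambda>j k. z j * cnj (w k) - w j * cnj (z k)) \<Longrightarrow> L v = br' (L z) (L w)"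
  shows "isomorphic_to br J br' (structure6 (quad_eval m))"
proof -
  obtain \<sigma> where cs: "complex_structure br J" and \<sigma>: "basis10 3 J \<sigma>"
    "ce_d br (\<sigma> 1) = 0" "ce_d br (\<sigma> 2) = 0"
    "\<And>x y. ce_d br (\<sigma> 3) x y = quad_eval m (\<lambda>j k. wedge_bar \<sigma> j k x y)"
    using str unfolding structure6_def by blast
  note J = complex_structureD[OF cs]
  \<comment> \<open>Linearity is known only for the forms with index \<open>1\<close>, \<open>2\<close>, \<open>3\<close>; the others are replaced by \<open>0\<close>.\<close>
  define s where "s x i = (if i \<in> {1..3} then \<sigma> i x else 0)" for x i
  have lin: "linear (\<lambda>x. s x i)" for i
    unfolding s_def using basis10_in_forms10[OF \<sigma>(1), of i, THEN forms10D(1)]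
    by (cases "i \<in> {1..3}") (auto intro: linearI)
  define \<phi> where "\<phi> x = L (s x)" for x
  have "linear \<phi>"
  proof (rule linearI)
    show "\<phi> (x + y) = \<phi> x + \<phi> y" for x y
      unfolding \<phi>_def add[symmetric] linear_add[OF lin, symmetric] ..
    show "\<phi> (t *\<^sub>R x) = t *\<^sub>R \<phi> x" for t x
      unfolding \<phi>_def scale[symmetric] linear_scale[OF lin, symmetric] ..
  qed
  moreover have "bij \<phi>"
  proof (rule linear_injective_imp_bij[OF \<open>linear \<phi>\<close>])
    fix x assume "\<phi> x = 0"
    then show "x = 0"
      using ker[of "s x"] by (intro basis10_3_separates[OF J \<sigma>(1)]) (auto simp: \<phi>_def s_def)
  qed (simp add: dim)
  moreover have "\<phi> (br x y) = br' (\<phi> x) (\<phi> y)" for x y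
    unfolding \<phi>_def
  proof (rule hom)
    show "s (br x y) 1 = 0" "s (br x y) 2 = 0"
      using \<sigma>(2,3) by (auto simp: s_def ce_d_def fun_eq_iff)
    show "s (br x y) 3 = - quad_eval m (\<lambda>j k. s x j * cnj (s y k) - s y j * cnj (s x k))"
      using \<sigma>(4)[of x y] 
      by (cases m) (simp add: s_def ce_d_def wedge_bar_def wedge_def cnj_form_def algebra_simps)
  qed
  moreover define J' where "J' y = \<phi> (J (inv_into UNIV \<phi> y))" for y
  ultimately have iso: "cs_isomorphism br J br' J' \<phi>"
    unfolding cs_isomorphism_def by (auto simp: bij_is_inj)
  have "structure6 (quad_eval m) br' J'"
    by (rule structure6_isomorphism[OF _ str iso]) simp
  with iso show ?thesis unfolding isomorphic_to_def by blast
qed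

section \<open>Real coframes for the normal forms\<close>

lemmas salamon_coords = Finite_Cartesian_Product.vec_eq_iff forall_6 salamon_def e2_def wedge_def

lemma J_s1_eq_quad: "J_s1 = structure6 (quad_eval (0, 1, 0, 0))"
  by (simp add: J_s1_def quad_eval.simps[abs_def])

text \<open>Coframe: \<open>\<sigma>\<^sup>1 = e\<^sup>1 + \<i> e\<^sup>2\<close>, \<open>\<sigma>\<^sup>2 = e\<^sup>3 - \<i> e\<^sup>4\<close>, \<open>\<sigma>\<^sup>3 = e\<^sup>5 + \<i> e\<^sup>6\<close>.\<close>

lemma isomorphic_to_h5_s1:
  fixes J :: "'g::real_vector \<Rightarrow> 'g"
  assumes "dim (UNIV :: 'g set) = 6" "structure6 (quad_eval (0, 1, 0, 0)) br J"
  shows "isomorphic_to br J lie_h5 (J_s1)"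
  unfolding J_s1_eq_quad
proof (rule isomorphic_to_structure6I[OF assms(1,2)])
  let ?L = "\<lambda>z. vec6 (Re (z 1)) (Im (z 1)) (Re (z 2)) (- Im (z 2)) (Re (z 3)) (Im (z 3))"
  show "?L (\<lambda>i. z i + w i) = ?L z + ?L w" for z w
    by (simp add: salamon_coords add_divide_distrib diff_divide_distrib algebra_simps)
  show "?L (\<lambda>i. t *\<^sub>R z i) = t *\<^sub>R ?L z" for t z
    by (simp add: salamon_coords algebra_simps)
  show "z 1 = 0 \<and> z 2 = 0 \<and> z 3 = 0" if "?L z = 0" for z
    using that by (auto simp: salamon_coords complex_eq_iff)
  show "?L v = lie_h5 (?L z) (?L w)"
    if "v 1 = 0" "v 2 = 0" "v 3 = - quad_eval (0, 1, 0, 0) (\<lambda>j k. z j * cnj (w k) - w j * cnj (z k))" for z w v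
    by (simp add: that lie_h5_def salamon_coords field_simps)
qed

lemma J_320_eq_quad: "J_320 = structure6 (quad_eval (1, 0, 0, 1))"
  by (simp add: J_320_def quad_eval.simps[abs_def])

text \<open>The form \<open>\<sigma> \<and> cnj \<sigma>\<close> is \<open>- 2 \<i>\<close> times the product of the real and imaginary parts of \<open>\<sigma>\<close>. Hence
  \<open>\<sigma>\<^sup>1 = e\<^sup>1 + \<i> e\<^sup>2\<close>, \<open>\<sigma>\<^sup>2 = e\<^sup>3 + \<i> e\<^sup>4\<close>, \<open>\<sigma>\<^sup>3 = e\<^sup>5 - 2 \<i> e\<^sup>6\<close>.\<close>

lemma isomorphic_to_h3_320:
  fixes J :: "'g::real_vector \<Rightarrow> 'g"
  assumes "dim (UNIV :: 'g set) = 6" "structure6 (quad_eval (1, 0, 0, 1)) br J"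
  shows "isomorphic_to br J lie_h3 (J_320)"
  unfolding J_320_eq_quad
proof (rule isomorphic_to_structure6I[OF assms(1,2)])
  let ?L = "\<lambda>z. vec6 (Re (z 1)) (Im (z 1)) (Re (z 2)) (Im (z 2)) (Re (z 3)) (- Im (z 3) / 2)"
  show "?L (\<lambda>i. z i + w i) = ?L z + ?L w" for z w
    by (simp add: salamon_coords add_divide_distrib diff_divide_distrib algebra_simps)
  show "?L (\<lambda>i. t *\<^sub>R z i) = t *\<^sub>R ?L z" for t z
    by (simp add: salamon_coords algebra_simps)
  show "z 1 = 0 \<and> z 2 = 0 \<and> z 3 = 0" if "?L z = 0" for z
    using that by (auto simp: salamon_coords complex_eq_iff)
  show "?L v = lie_h3 (?L z) (?L w)"
    if "v 1 = 0" "v 2 = 0" "v 3 = - quad_eval (1, 0, 0, 1) (\<lambda>j k. z j * cnj (w k) - w j * cnj (z k))" for z w v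
    by (simp add: that lie_h3_def salamon_coords field_simps)
qed

lemma J_310_eq_quad: "J_310 = structure6 (quad_eval (1, 0, 0, -1))"
  by (simp add: J_310_def quad_eval.simps[abs_def])

text \<open>As for \<open>J_320\<close>, with \<open>\<sigma>\<^sup>2 = e\<^sup>3 - \<i> e\<^sup>4\<close> to reverse the sign of \<open>\<sigma>\<^sup>2 \<and> cnj \<sigma>\<^sup>2\<close>.\<close>

lemma isomorphic_to_h3_310:
  fixes J :: "'g::real_vector \<Rightarrow> 'g"
  assumes "dim (UNIV :: 'g set) = 6" "structure6 (quad_eval (1, 0, 0, -1)) br J"
  shows "isomorphic_to br J lie_h3 (J_310)"
  unfolding J_310_eq_quad
proof (rule isomorphic_to_structure6I[OF assms(1,2)])
  let ?L = "\<lambda>z. vec6 (Re (z 1)) (Im (z 1)) (Re (z 2)) (- Im (z 2)) (Re (z 3)) (- Im (z 3) / 2)"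
  show "?L (\<lambda>i. z i + w i) = ?L z + ?L w" for z w
    by (simp add: salamon_coords add_divide_distrib diff_divide_distrib algebra_simps)
  show "?L (\<lambda>i. t *\<^sub>R z i) = t *\<^sub>R ?L z" for t z
    by (simp add: salamon_coords algebra_simps)
  show "z 1 = 0 \<and> z 2 = 0 \<and> z 3 = 0" if "?L z = 0" for z
    using that by (auto simp: salamon_coords complex_eq_iff)
  show "?L v = lie_h3 (?L z) (?L w)"
    if "v 1 = 0" "v 2 = 0" "v 3 = - quad_eval (1, 0, 0, -1) (\<lambda>j k. z j * cnj (w k) - w j * cnj (z k))" for z w v
    by (simp add: that lie_h3_def salamon_coords field_simps)
qed

lemma J_r1_eq_quad: "J_r1 = structure6 (quad_eval (0, 1, 1, \<i>))"
  by (simp add: J_r1_def quad_eval.simps[abs_def])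

text \<open>Coframe: \<open>\<sigma>\<^sup>1 = e\<^sup>3 - \<i> e\<^sup>4\<close>, \<open>\<sigma>\<^sup>2 = e\<^sup>1 + \<i> e\<^sup>2\<close>, \<open>\<sigma>\<^sup>3 = 2 e\<^sup>5 + 2 \<i> e\<^sup>6\<close>. The order is reversed because
  \<open>\<i> \<sigma>\<^sup>2 \<and> cnj \<sigma>\<^sup>2\<close> is the only source of the decomposable form \<open>12\<close>.\<close>

lemma isomorphic_to_h4_r1:
  fixes J :: "'g::real_vector \<Rightarrow> 'g"
  assumes "dim (UNIV :: 'g set) = 6" "structure6 (quad_eval (0, 1, 1, \<i>)) br J"
  shows "isomorphic_to br J lie_h4 (J_r1)"
  unfolding J_r1_eq_quad
proof (rule isomorphic_to_structure6I[OF assms(1,2)])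
  let ?L = "\<lambda>z. vec6 (Re (z 2)) (Im (z 2)) (Re (z 1)) (- Im (z 1)) (Re (z 3) / 2) (Im (z 3) / 2)"
  show "?L (\<lambda>i. z i + w i) = ?L z + ?L w" for z w
    by (simp add: salamon_coords add_divide_distrib diff_divide_distrib algebra_simps)
  show "?L (\<lambda>i. t *\<^sub>R z i) = t *\<^sub>R ?L z" for t z
    by (simp add: salamon_coords algebra_simps)
  show "z 1 = 0 \<and> z 2 = 0 \<and> z 3 = 0" if "?L z = 0" for z
    using that by (auto simp: salamon_coords complex_eq_iff)
  show "?L v = lie_h4 (?L z) (?L w)"
    if "v 1 = 0" "v 2 = 0" "v 3 = - quad_eval (0, 1, 1, \<i>) (\<lambda>j k. z j * cnj (w k) - w j * cnj (z k))" for z w v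
    by (simp add: that lie_h4_def salamon_coords field_simps)
qed

lemma J_r2_eq_quad: "J_r2 \<mu> = structure6 (quad_eval (0, 1, of_real \<mu>, 0))"
  by (simp add: J_r2_def quad_eval.simps[abs_def])

text \<open>Coframe: \<open>\<sigma>\<^sup>1\<close> and \<open>\<sigma>\<^sup>2\<close> as for \<open>J_s1\<close>. Since \<open>\<sigma>\<^sup>2 \<and> cnj \<sigma>\<^sup>1\<close> is minus the conjugate of
  \<open>\<sigma>\<^sup>1 \<and> cnj \<sigma>\<^sup>2\<close>, the real and imaginary parts are multiplied by \<open>1 - \<mu>\<close> and \<open>1 + \<mu>\<close>; hence
  \<open>\<sigma>\<^sup>3 = (1 - \<mu>) e\<^sup>5 + \<i> (1 + \<mu>) e\<^sup>6\<close>.\<close>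

lemma isomorphic_to_h5_r2:
  fixes J :: "'g::real_vector \<Rightarrow> 'g"
  assumes "dim (UNIV :: 'g set) = 6" "structure6 (quad_eval (0, 1, of_real \<mu>, 0)) br J" "1 < \<mu>"
  shows "isomorphic_to br J lie_h5 (J_r2 \<mu>)"
  unfolding J_r2_eq_quad
proof (rule isomorphic_to_structure6I[OF assms(1,2)])
  let ?L = "\<lambda>z. vec6 (Re (z 1)) (Im (z 1)) (Re (z 2)) (- Im (z 2)) (Re (z 3) / (1 - \<mu>)) (Im (z 3) / (1 + \<mu>))"
  show "?L (\<lambda>i. z i + w i) = ?L z + ?L w" for z w
    by (simp add: salamon_coords add_divide_distrib diff_divide_distrib algebra_simps)
  show "?L (\<lambda>i. t *\<^sub>R z i) = t *\<^sub>R ?L z" for t z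
    by (simp add: salamon_coords algebra_simps)
  show "z 1 = 0 \<and> z 2 = 0 \<and> z 3 = 0" if "?L z = 0" for z
    using that assms(3) by (auto simp: salamon_coords complex_eq_iff)
  show "?L v = lie_h5 (?L z) (?L w)"
    if "v 1 = 0" "v 2 = 0" "v 3 = - quad_eval (0, 1, of_real \<mu>, 0) (\<lambda>j k. z j * cnj (w k) - w j * cnj (z k))" for z w v
    using assms(3) by (simp add: that lie_h5_def salamon_coords field_simps)
qed

lemma J_r3_eq_quad: "J_r3 \<theta> = structure6 (quad_eval (1, 0, 0, cis \<theta>))"
  by (simp add: J_r3_def quad_eval.simps[abs_def])

text \<open>Coframe: \<open>\<sigma>\<^sup>1\<close> and \<open>\<sigma>\<^sup>2\<close> as for \<open>J_320\<close>, and \<open>\<sigma>\<^sup>3 = - 2 \<i> (e\<^sup>5 + cis \<theta> e\<^sup>6)\<close>, where \<open>e\<^sup>5\<close> and \<open>e\<^sup>6\<close> can be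
  solved for because \<open>cis \<theta>\<close> is not real.\<close>

lemma isomorphic_to_h2_r3:
  fixes J :: "'g::real_vector \<Rightarrow> 'g"
  assumes "dim (UNIV :: 'g set) = 6" "structure6 (quad_eval (1, 0, 0, cis \<theta>)) br J" "0 < \<theta>" "\<theta> < pi"
  shows "isomorphic_to br J lie_h2 (J_r3 \<theta>)"
  unfolding J_r3_eq_quad
proof (rule isomorphic_to_structure6I[OF assms(1,2)])
  have "sin \<theta> \<noteq> 0" using sin_gt_zero assms(3,4) by force
  let ?L = "\<lambda>z. vec6 (Re (z 1)) (Im (z 1)) (Re (z 2)) (Im (z 2))
    (- Im (z 3) / 2 - cos \<theta> * Re (z 3) / (2 * sin \<theta>)) (Re (z 3) / (2 * sin \<theta>))"
  show "?L (\<lambda>i. z i + w i) = ?L z + ?L w" for z w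
    by (simp add: salamon_coords add_divide_distrib diff_divide_distrib algebra_simps)
  show "?L (\<lambda>i. t *\<^sub>R z i) = t *\<^sub>R ?L z" for t z
    by (simp add: salamon_coords algebra_simps)
  show "z 1 = 0 \<and> z 2 = 0 \<and> z 3 = 0" if "?L z = 0" for z
    using that \<open>sin \<theta> \<noteq> 0\<close> by (auto simp: salamon_coords complex_eq_iff)
  show "?L v = lie_h2 (?L z) (?L w)"
    if "v 1 = 0" "v 2 = 0" "v 3 = - quad_eval (1, 0, 0, cis \<theta>) (\<lambda>j k. z j * cnj (w k) - w j * cnj (z k))" for z w v
    using \<open>sin \<theta> \<noteq> 0\<close> by (simp add: that lie_h2_def salamon_coords field_simps)
qed

section \<open>Matrices defining a structure\<close>

definition quad_of_mat :: "complex mat \<Rightarrow> quad" where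
  "quad_of_mat M = (M $$ (0, 0), M $$ (0, 1), M $$ (1, 0), M $$ (1, 1))"

lemma defining_matrix_structure6:
  assumes "complex_structure br J" "defining_matrix 3 br J \<omega> M"
  shows "structure6 (quad_eval (quad_of_mat M)) br J"
proof -
  have I: "{1..3 - 1} = {1, 2::nat}" by auto
  show ?thesis
    using assms unfolding structure6_def defining_matrix_def I
    by (intro conjI exI[of _ \<omega>]) (auto simp: quad_of_mat_def algebra_simps One_nat_def)
qed

lemma mat_adjoint_index:
  fixes A :: "complex mat"
  assumes "A \<in> carrier_mat n n" "i < n" "j < n"
  shows "mat_adjoint A $$ (i, j) = cnj (A $$ (j, i))"
  using assms by (simp add: mat_adjoint_def mat_of_rows_index)

lemma mat_adjoint_carrier: "A \<in> carrier_mat n m \<Longrightarrow> mat_adjoint A \<in> carrier_mat m n"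
  unfolding mat_adjoint_def by (rule carrier_matI) auto

lemma less_2_cases: "i < (2::nat) \<Longrightarrow> i = 0 \<or> i = 1" by auto

lemma hermitian_quad_of_mat:
  assumes "M \<in> carrier_mat 2 2"
  shows "hermitian_mat M \<longleftrightarrow> hermitian_quad (quad_of_mat M)"
proof
  assume "hermitian_mat M"
  then have "M $$ (i, j) = mat_adjoint M $$ (i, j)" for i j
    unfolding hermitian_mat_def by (rule arg_cong)
  then have "M $$ (i, j) = cnj (M $$ (j, i))" if "i < 2" "j < 2" for i j
    using mat_adjoint_index[OF assms that] by metis
  note entry = this[symmetric]
  show "hermitian_quad (quad_of_mat M)"
    unfolding quad_of_mat_def hermitian_quad.simps
    by (intro conjI entry entry[symmetric]) simp_all
next
  assume h: "hermitian_quad (quad_of_mat M)"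
  have adj: "mat_adjoint M \<in> carrier_mat 2 2" by (rule mat_adjoint_carrier[OF assms])
  show "hermitian_mat M"
    unfolding hermitian_mat_def
  proof (rule eq_matI)
    fix i j assume "i < dim_row (mat_adjoint M)" "j < dim_col (mat_adjoint M)"
    then have "i < 2" "j < 2" using adj by auto
    then show "M $$ (i, j) = mat_adjoint M $$ (i, j)"
      using h mat_adjoint_index[OF assms, of i j] less_2_cases[of i] less_2_cases[of j]
      by (auto simp: quad_of_mat_def)
  qed (use assms adj in auto)
qed

lemma structure6_hermitian_case:
  assumes "structure6 (quad_eval h) br J" "hermitian_quad h" "quad_det h \<noteq> 0"
  shows "hermitian_case 3 br J"
proof -
  obtain a b c d where h: "h = (a, b, c, d)" by (cases h)
  define M where "M = Matrix.mat 2 2 (\<lambda>(i, j). if i = 0 then (if j = 0 then a else b) else (if j = 0 then c else d))"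
  have M: "M \<in> carrier_mat 2 2" "quad_of_mat M = h"
    by (auto simp: M_def h quad_of_mat_def)
  have "M \<noteq> 0\<^sub>m 2 2"
    using assms(3) M(2) by (auto simp: quad_of_mat_def)
  obtain \<sigma> where \<sigma>: "basis10 3 J \<sigma>" "ce_d br (\<sigma> 1) = 0" "ce_d br (\<sigma> 2) = 0"
    "\<And>x y. ce_d br (\<sigma> 3) x y = quad_eval h (\<lambda>j k. wedge_bar \<sigma> j k x y)"
    using assms(1) unfolding structure6_def by blast
  have I: "{1..3 - 1} = {1, 2::nat}" by auto
  have "defining_matrix 3 br J \<sigma> M"
    unfolding defining_matrix_def I using \<sigma> M \<open>M \<noteq> 0\<^sub>m 2 2\<close>
    by (auto simp: fun_eq_iff quad_of_mat_def algebra_simps One_nat_def simp flip: M(2))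
  moreover have "hermitian_mat M" using hermitian_quad_of_mat[OF M(1)] M(2) assms(2) by simp
  ultimately show ?thesis unfolding hermitian_case_def by blast
qed

lemma mult_mat_2_index:
  fixes A B :: "complex mat"
  assumes "A \<in> carrier_mat 2 2" "B \<in> carrier_mat 2 2" "i < 2" "j < 2"
  shows "(A * B) $$ (i, j) = A $$ (i, 0) * B $$ (0, j) + A $$ (i, 1) * B $$ (1, j)"
  using assms by (simp add: scalar_prod_def numeral_2_eq_2 One_nat_def)

lemma quad_det_invertible_mat:
  assumes "M \<in> carrier_mat 2 2" "invertible_mat M"
  shows "quad_det (quad_of_mat M) \<noteq> 0"
proof
  assume 0: "quad_det (quad_of_mat M) = 0"
  obtain B where B: "M * B = 1\<^sub>m 2" "B * M = 1\<^sub>m (dim_row B)"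
    using assms unfolding invertible_mat_def inverts_mat_def by auto
  have "B \<in> carrier_mat 2 2"
    using B assms by (metis carrier_matD carrier_matI index_mult_mat(2,3) index_one_mat(2,3))
  note ix = mult_mat_2_index[OF assms(1) this, unfolded B(1)]
  have "(M $$ (0, 0) * M $$ (1, 1) - M $$ (0, 1) * M $$ (1, 0)) *
      (B $$ (0, 0) * B $$ (1, 1) - B $$ (0, 1) * B $$ (1, 0)) =
    1\<^sub>m 2 $$ (0, 0) * 1\<^sub>m 2 $$ (1, 1) - 1\<^sub>m 2 $$ (0, 1) * 1\<^sub>m 2 $$ (1, 0)"
    by (simp add: ix del: index_one_mat) (simp add: algebra_simps)
  with 0 show False by (simp add: quad_of_mat_def)
qed

lemma corank_0_invertible:
  assumes "M \<in> carrier_mat n n" "corank M = 0"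
  shows "invertible_mat M"
proof -
  have "n \<le> vec_space.rank n M" using assms by (simp add: corank_def)
  moreover have "vec_space.rank n M \<le> n" by (rule vec_space.rank_le_nc[OF assms(1)])
  ultimately have "Determinant.det M \<noteq> 0" using vec_space.det_rank_iff[OF assms(1)] by simp
  then have "M \<in> Units (ring_mat TYPE(complex) n 0)" by (rule det_non_zero_imp_unit[OF assms(1)])
  then obtain B where "B \<in> carrier_mat n n" "B * M = 1\<^sub>m n" "M * B = 1\<^sub>m n"
    unfolding Units_def ring_mat_def by auto
  then show ?thesis using assms(1) unfolding invertible_mat_def inverts_mat_def by auto
qed

text \<open>The corank is \<open>0\<close> only for an invertible matrix and \<open>2\<close> only for the zero matrix, so it is \<open>1\<close>. Maximal type
  then says that the entry \<open>N\<close> of \<open>S M S\<^sup>*\<close> is nonzero, and the second row vanishes.\<close>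

lemma singular_maximal_type_congruent:
  assumes M: "M \<in> carrier_mat 2 2" "M \<noteq> 0\<^sub>m 2 2" and sing: "singular_maximal_type M"
  shows "congruent (quad_of_mat M) (0, 1, 0, 0)"
proof -
  have ninv: "\<not> invertible_mat M" and odr: "off_diagonal_rank M (corank M)"
    using sing by (auto simp: singular_maximal_type_def)
  obtain S M' N where S: "S \<in> carrier_mat 2 2" "invertible_mat S"
    and rows: "\<And>i. i \<in> {2 - corank M..<2} \<Longrightarrow> row (S * M) i = 0\<^sub>v 2"
    and M': "M' \<in> carrier_mat (2 - corank M) (2 - corank M)"
    and N: "N \<in> carrier_mat (2 - corank M) (corank M)"
    and eq: "S * M * mat_adjoint S =
      four_block_mat M' N (0\<^sub>m (corank M) (2 - corank M)) (0\<^sub>m (corank M) (corank M))"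
    and rank: "corank M = vec_space.rank (2 - corank M) N"
    using odr M(1) unfolding off_diagonal_rank_def Let_def by auto
  have "corank M \<noteq> 0" using corank_0_invertible[OF M(1)] ninv by blast
  moreover have "corank M \<le> 2" using M(1) by (simp add: corank_def)
  moreover have "corank M \<noteq> 2"
  proof
    assume "corank M = 2"
    then have "row (S * M) i = 0\<^sub>v 2" if "i < 2" for i using rows that by simp
    then have "S * M = 0\<^sub>m 2 2"
      using S M by (intro eq_rowI) auto
    moreover obtain B where "B * S = 1\<^sub>m (dim_row B)" "S * B = 1\<^sub>m 2"
      using S unfolding invertible_mat_def inverts_mat_def by auto
    moreover from this S have "B \<in> carrier_mat 2 2"
      by (metis carrier_matD carrier_matI index_mult_mat(2,3) index_one_mat(2,3))
    ultimately have "M = 0\<^sub>m 2 2"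
      using S M by (metis assoc_mult_mat carrier_matD(1) left_mult_one_mat right_mult_zero_mat)
    with M show False by simp
  qed
  ultimately have c1: "corank M = 1" by simp
  have N1: "N \<in> carrier_mat 1 1" using N c1 by (simp add: One_nat_def)
  have "vec_space.rank 1 N = 1" using rank c1 by (simp add: One_nat_def)
  then have "Determinant.det N \<noteq> 0" using vec_space.det_rank_iff[OF N1] by simp
  then have N0: "N $$ (0, 0) \<noteq> 0" by (simp add: det_single[OF N1])
  have M'1: "M' \<in> carrier_mat 1 1" using M' c1 by (simp add: One_nat_def)
  let ?m = "quad_of_mat M" and ?s = "\<lambda>i. (S $$ (i, 0), S $$ (i, 1))"
  have adj: "mat_adjoint S \<in> carrier_mat 2 2" by (rule mat_adjoint_carrier[OF S(1)])
  have entry: "(S * M * mat_adjoint S) $$ (i, j) = sesq ?m (?s i) (?s j)" if "i < 2" "j < 2" for i j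
    using that S(1) M(1) adj
    by (simp add: mult_mat_2_index[of S] mult_mat_2_index[of M] mat_adjoint_index[OF S(1)]
        quad_of_mat_def algebra_simps del: index_mult_mat)
  have "congruent ?m (sesq ?m (?s 0) (?s 0), N $$ (0, 0), 0, 0)"
  proof (rule congruentI[where k = 1 and u = "?s 0" and v = "?s 1"])
    show "det2 (?s 0) (?s 1) \<noteq> 0"
      using quad_det_invertible_mat[OF S] by (simp add: quad_of_mat_def)
    show "1 * sesq ?m (?s 0) (?s 1) = N $$ (0, 0)" "1 * sesq ?m (?s 1) (?s 0) = 0"
      "1 * sesq ?m (?s 1) (?s 1) = 0"
      unfolding mult_1 using entry[of 0 1] entry[of 1 0] entry[of 1 1] M'1 N1
      by (simp_all add: eq c1)
  qed simp_all
  then show ?thesis using singular_row_normal_form[OF N0] congruent_trans by blast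
qed

section \<open>The centre and Hermitian matrices\<close>

text \<open>Evaluating the structure equation on \<open>x\<close> and on vectors with \<open>(\<sigma>\<^sup>1, \<sigma>\<^sup>2)\<close> equal to \<open>(1, 0)\<close>, \<open>(\<i>, 0)\<close>,
  \<open>(0, 1)\<close>, \<open>(0, \<i>)\<close> shows that \<open>(\<sigma>\<^sup>1 x, \<sigma>\<^sup>2 x)\<close> is in the left kernel of the matrix.\<close>

lemma central_vector_of_regular:
  fixes J :: "'g::real_vector \<Rightarrow> 'g"
  assumes dim: "dim (UNIV :: 'g set) = 6" and cs: "complex_structure br J" and \<sigma>: "basis10 3 J \<sigma>"
    and d: "\<And>x y. ce_d br (\<sigma> 3) x y = quad_eval m (\<lambda>j k. wedge_bar \<sigma> j k x y)"
    and m: "quad_det m \<noteq> 0" and x: "\<And>y. br x y = 0"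
  shows "\<sigma> 1 x = 0" "\<sigma> 2 x = 0"
proof -
  obtain a b c d where abcd: "m = (a, b, c, d)" by (cases m)
  have f: "\<sigma> 1 \<in> forms10 J" "\<sigma> 2 \<in> forms10 J" "\<sigma> 3 \<in> forms10 J"
    using basis10_in_forms10[OF \<sigma>] by auto
  note J = complex_structureD[OF cs]
  let ?p = "\<sigma> 1 x" and ?q = "\<sigma> 2 x"
  have z: "(a * ?p + c * ?q) * cnj r + (b * ?p + d * ?q) * cnj s
      - (a * cnj ?p + b * cnj ?q) * r - (c * cnj ?p + d * cnj ?q) * s = 0" for r s
  proof -
    obtain y where y: "\<sigma> 1 y = r" "\<sigma> 2 y = s" "\<sigma> 3 y = 0"
      by (rule basis10_3_coordinates[OF dim J \<sigma>])
    have "ce_d br (\<sigma> 3) x y = 0"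
      using x linear_0[OF forms10D(1)[OF f(3)]] by (simp add: ce_d_def)
    then show ?thesis
      unfolding d by (simp add: abcd wedge_bar_def wedge_def cnj_form_def y algebra_simps)
  qed
  have "a * ?p + c * ?q = 0" "b * ?p + d * ?q = 0"
    using z[of 1 0] z[of \<i> 0] z[of 0 1] z[of 0 \<i>] by (auto simp: complex_eq_iff)
  moreover have "(a * d - b * c) * ?p = d * (a * ?p + c * ?q) - c * (b * ?p + d * ?q)"
    "(a * d - b * c) * ?q = a * (b * ?p + d * ?q) - b * (a * ?p + c * ?q)"
    by (simp_all add: algebra_simps)
  ultimately show "?p = 0" "?q = 0" using m abcd by auto
qed

text \<open>A regular matrix forces the centre to be the complex line where \<open>\<sigma>\<^sup>1\<close> and \<open>\<sigma>\<^sup>2\<close> vanish. If \<open>h\<close> were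
  singular, then its left radical, which is also its right radical as \<open>h\<close> is Hermitian, would yield a central
  vector \<open>x\<close> with \<open>(\<tau>\<^sup>1 x, \<tau>\<^sup>2 x) \<noteq> 0\<close>. The vector \<open>z\<close> dual to \<open>\<tau>\<^sup>3\<close> is central too, so \<open>x\<close> and \<open>z\<close> would
  lie on one complex line, on which \<open>\<tau>\<^sup>1\<close> and \<open>\<tau>\<^sup>2\<close> vanish.\<close>

lemma hermitian_representative_regular:
  fixes J :: "'g::real_vector \<Rightarrow> 'g"
  assumes dim: "dim (UNIV :: 'g set) = 6"
    and m: "structure6 (quad_eval m) br J" "quad_det m \<noteq> 0"
    and h: "structure6 (quad_eval h) br J" "hermitian_quad h"
  shows "quad_det h \<noteq> 0"
proof
  assume 0: "quad_det h = 0"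
  obtain a b c d where abcd: "h = (a, b, c, d)" by (cases h)
  have herm: "cnj a = a" "cnj d = d" "c = cnj b" using h(2) abcd by auto
  obtain \<sigma> where cs: "complex_structure br J" and \<sigma>: "basis10 3 J \<sigma>"
    "\<And>x y. ce_d br (\<sigma> 3) x y = quad_eval m (\<lambda>j k. wedge_bar \<sigma> j k x y)"
    using m(1) unfolding structure6_def by blast
  obtain \<tau> where \<tau>: "basis10 3 J \<tau>" "ce_d br (\<tau> 1) = 0" "ce_d br (\<tau> 2) = 0"
    "\<And>x y. ce_d br (\<tau> 3) x y = quad_eval h (\<lambda>j k. wedge_bar \<tau> j k x y)"
    using h(1) unfolding structure6_def by blast
  note J = complex_structureD[OF cs]
  have \<sigma>f: "\<sigma> 1 \<in> forms10 J" "\<sigma> 2 \<in> forms10 J" "\<sigma> 3 \<in> forms10 J"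
    using basis10_in_forms10[OF \<sigma>(1)] by auto
  have \<tau>f: "\<tau> 1 \<in> forms10 J" "\<tau> 2 \<in> forms10 J" "\<tau> 3 \<in> forms10 J"
    using basis10_in_forms10[OF \<tau>(1)] by auto
  note coords = basis10_3_coordinates[OF dim J \<tau>(1)]
  obtain p q where pq: "(p, q) \<noteq> (0, 0)" "a * p + c * q = 0" "b * p + d * q = 0"
    using singular_left_kernel[of a d b c] 0 abcd by auto
  obtain x where x: "\<tau> 1 x = p" "\<tau> 2 x = q" "\<tau> 3 x = 0" by (rule coords)
  obtain z where z: "\<tau> 1 z = 0" "\<tau> 2 z = 0" "\<tau> 3 z = 1" by (rule coords)
  have central: "br v y = 0"
    if "a * \<tau> 1 v + c * \<tau> 2 v = 0" "b * \<tau> 1 v + d * \<tau> 2 v = 0" for v y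
  proof (rule basis10_3_separates[OF J \<tau>(1)])
    show "\<tau> 1 (br v y) = 0" "\<tau> 2 (br v y) = 0"
      using \<tau>(2,3) by (auto simp: ce_d_def fun_eq_iff)
    have "- \<tau> 3 (br v y) = (a * \<tau> 1 v + c * \<tau> 2 v) * cnj (\<tau> 1 y) + (b * \<tau> 1 v + d * \<tau> 2 v) * cnj (\<tau> 2 y)
        - cnj (a * \<tau> 1 v + c * \<tau> 2 v) * \<tau> 1 y - cnj (b * \<tau> 1 v + d * \<tau> 2 v) * \<tau> 2 y"
      using \<tau>(4)[of v y]
      by (simp add: ce_d_def abcd wedge_bar_def wedge_def cnj_form_def herm algebra_simps)
    then show "\<tau> 3 (br v y) = 0" by (simp only: that) simp
  qed
  have cx: "\<sigma> 1 x = 0" "\<sigma> 2 x = 0"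
    by (rule central_vector_of_regular[OF dim cs \<sigma> m(2) central]; simp add: x pq)+
  have cz: "\<sigma> 1 z = 0" "\<sigma> 2 z = 0"
    by (rule central_vector_of_regular[OF dim cs \<sigma> m(2) central]; simp add: z)+
  have "\<sigma> 3 z \<noteq> 0"
  proof
    assume "\<sigma> 3 z = 0"
    then have "z = 0" using basis10_3_separates[OF J \<sigma>(1) cz] by simp
    then show False using z(3) linear_0[OF forms10D(1)[OF \<tau>f(3)]] by simp
  qed
  define t where "t = \<sigma> 3 x / \<sigma> 3 z"
  let ?y = "Re t *\<^sub>R z + Im t *\<^sub>R J z"
  have tz: "\<alpha> ?y = t * \<alpha> z" if "\<alpha> \<in> forms10 J" for \<alpha>
    by (simp add: forms10_add[OF that] forms10_scale[OF that] forms10D(2)[OF that] complex_eq_iff)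
  have "x - ?y = 0"
  proof (rule basis10_3_separates[OF J \<sigma>(1)])
    show "\<sigma> 1 (x - ?y) = 0" "\<sigma> 2 (x - ?y) = 0"
      unfolding linear_diff[OF forms10D(1)[OF \<sigma>f(1)]] linear_diff[OF forms10D(1)[OF \<sigma>f(2)]]
        tz[OF \<sigma>f(1)] tz[OF \<sigma>f(2)] by (simp_all add: cx cz)
    show "\<sigma> 3 (x - ?y) = 0"
      unfolding linear_diff[OF forms10D(1)[OF \<sigma>f(3)]] tz[OF \<sigma>f(3)]
      using \<open>\<sigma> 3 z \<noteq> 0\<close> by (simp add: t_def)
  qed
  then have "x = ?y" by simp
  then have "\<tau> 1 x = t * \<tau> 1 z" "\<tau> 2 x = t * \<tau> 2 z"
    using tz[OF \<tau>f(1)] tz[OF \<tau>f(2)] by metis+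
  then show False using pq(1) x z by simp
qed

section \<open>The classification\<close>

theorem theorem4p14:
  fixes br :: "'g::real_vector \<Rightarrow> 'g \<Rightarrow> 'g" and J :: "'g \<Rightarrow> 'g"
    and \<omega> :: "nat \<Rightarrow> 'g \<Rightarrow> complex" and M :: "complex mat"
  assumes "one_abelian 3 br J"
    and "defining_matrix 3 br J \<omega> M"
  shows "(singular_maximal_type M \<longrightarrow> isomorphic_to br J lie_h5 J_s1) \<and>
    (invertible_mat M \<and> hermitian_case 3 br J \<longrightarrow>
      isomorphic_to br J lie_h3 J_320 \<or> isomorphic_to br J lie_h3 J_310) \<and>
    (invertible_mat M \<and> \<not> hermitian_case 3 br J \<longrightarrow>
      isomorphic_to br J lie_h4 J_r1 \<or>
      (\<exists>\<mu>. 1 < \<mu> \<and> isomorphic_to br J lie_h5 (J_r2 \<mu>)) \<or>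
      (\<exists>\<theta>. 0 < \<theta> \<and> \<theta> < pi \<and> isomorphic_to br J lie_h2 (J_r3 \<theta>)))"
proof -
  have dim: "dim (UNIV :: 'g set) = 6" and cs: "complex_structure br J"
    using assms(1) unfolding one_abelian_def abelian_complex_structure_def by auto
  have M: "M \<in> carrier_mat 2 2" "M \<noteq> 0\<^sub>m 2 2"
    using assms(2) unfolding defining_matrix_def by auto
  note str = defining_matrix_structure6[OF cs assms(2)]
  note normal = structure6_congruent[OF dim str]
  show ?thesis
  proof (intro conjI impI)
    assume "singular_maximal_type M"
    then show "isomorphic_to br J lie_h5 J_s1"
      using isomorphic_to_h5_s1[OF dim] normal singular_maximal_type_congruent[OF M] by blast
  next
    assume inv: "invertible_mat M \<and> hermitian_case 3 br J"
    then obtain \<omega>' H where H: "defining_matrix 3 br J \<omega>' H" "hermitian_mat H"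
      unfolding hermitian_case_def by blast
    then have "H \<in> carrier_mat 2 2" unfolding defining_matrix_def by auto
    with H have herm: "hermitian_quad (quad_of_mat H)" using hermitian_quad_of_mat by blast
    note strH = defining_matrix_structure6[OF cs H(1)]
    have "quad_det (quad_of_mat H) \<noteq> 0"
      using hermitian_representative_regular[OF dim str _ strH herm] quad_det_invertible_mat[OF M(1)] inv
      by blast
    from hermitian_normal_form[OF this herm]
    show "isomorphic_to br J lie_h3 J_320 \<or> isomorphic_to br J lie_h3 J_310"
      using structure6_congruent[OF dim strH] isomorphic_to_h3_320[OF dim] isomorphic_to_h3_310[OF dim]
      by blast
  next
    assume inv: "invertible_mat M \<and> \<not> hermitian_case 3 br J"
    then have regular: "quad_det (quad_of_mat M) \<noteq> 0" using quad_det_invertible_mat[OF M(1)] by blast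
    have "\<not> (hermitian_quad h \<and> congruent (quad_of_mat M) h)" for h
      using structure6_hermitian_case[OF normal] quad_det_congruent[OF _ regular] inv by blast
    with regular_normal_form[OF regular]
    show "isomorphic_to br J lie_h4 J_r1 \<or>
      (\<exists>\<mu>. 1 < \<mu> \<and> isomorphic_to br J lie_h5 (J_r2 \<mu>)) \<or>
      (\<exists>\<theta>. 0 < \<theta> \<and> \<theta> < pi \<and> isomorphic_to br J lie_h2 (J_r3 \<theta>))"
      using normal isomorphic_to_h4_r1[OF dim] isomorphic_to_h5_r2[OF dim] isomorphic_to_h2_r3[OF dim]
      by blast
  qed
qed

end
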